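(* Let $(w_\tau)_{\tau\searrow0}\subset L^2(\Omega)$ satisfy $w_\tau=P_\tau w_\tau$ for all $\tau$, and suppose that, for some $C>0$, $\sup_{\tau\searrow0}\mathrm{TV}_\tau(w_\tau)\le C$ and $\sup_{\tau\searrow0}\|w_\tau\|_{L^1(\Omega)}\le C$. Then there exist a subsequence of $(w_\tau)_\tau$ (not relabeled) and $w\in BV(\Omega)$ such that $w_\tau\to w$ in $L^1(\Omega)$ along this subsequence.
   Context: $\Omega=(a_1,b_1)\times\dots\times(a_n,b_n)\subset\mathbb{R}^n$, $n\in\{1,2,3\}$, is a bounded box. For mesh sizes $\tau\searrow0$, $\tilde{\mathcal{Q}}_\tau=\{\tilde Q_\tau^1,\dots,\tilde Q_\tau^{N_\tau}\}$ is an axis-aligned grid partitioning $\Omega$: each cell is a product $I_1^{k_1}\times\dots\times I_n^{k_n}$, where for each coordinate $i$ the intervals $I_i^1,\dots,I_i^{N_i}$ (depending on $\tau$) are consecutive and partition $(a_i,b_i)$ (up to endpoints). The grids satisfy bounded eccentricity: there is a constant independent of $\tau$ such that every cell lies in a closed ball whose measure is at most that constant times the measure of the cell. $P_\tau g=\sum_j1_{\tilde Q_\tau^j}\frac1{\operatorname{meas}\tilde Q_\tau^j}\int_{\tilde Q_\tau^j}g$ is averaging on the cells of $\tilde{\mathcal{Q}}_\tau$. $RT0_0^\tau$ is the space of lowest-order Raviart–Thomas fields on $\tilde{\mathcal{Q}}_\tau$ with vanishing normal trace: $\phi=(\phi_1,\dots,\phi_n)\in L^2(\Omega,\mathbb{R}^n)$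 with $\mathrm{div}\,\phi\in L^2(\Omega)$ and zero normal trace on $\partial\Omega$ such that on each cell $\phi_i(x)=\alpha_i+\beta_ix_i$ for constants $\alpha_i,\beta_i$ depending on the cell (equivalently, normal components are constant and continuous across cell facets). For $w\in L^2(\Omega)$, $\mathrm{TV}_\tau(w):=\sup\{\int_\Omega w\,\mathrm{div}\,\phi:\phi\in RT0_0^\tau,\ \|\phi\|_{L^\infty(\Omega,\mathbb{R}^n)}\le1\}$, with the Euclidean norm on $\mathbb{R}^n$. *)

theory Defs
  imports "HOL-Analysis.Analysis"
begin

section \<open>Square-integrable fields and test functions\<close>

text \<open>
  Elements of Lebesgue spaces over \<open>\<Omega>\<close> are represented by functions on the whole space;
  only their values on \<open>\<Omega>\<close> up to null sets matter.
\<close>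

definition L2_on :: "'a::euclidean_space set \<Rightarrow> ('a \<Rightarrow> 'b::euclidean_space) \<Rightarrow> bool" where
  "L2_on \<Omega> f \<longleftrightarrow> f \<in> borel_measurable (lebesgue_on \<Omega>) \<and>
     integrable (lebesgue_on \<Omega>) (\<lambda>x. (norm (f x))\<^sup>2)"

definition C1 :: "('a::euclidean_space \<Rightarrow> 'b::euclidean_space) \<Rightarrow> bool" where
  "C1 f \<longleftrightarrow> f differentiable_on UNIV \<and>
     (\<forall>h. continuous_on UNIV (\<lambda>x. frechet_derivative f (at x) h))"

definition C1_compact :: "'a::euclidean_space set \<Rightarrow> ('a \<Rightarrow> 'b::euclidean_space) \<Rightarrow> bool" where
  "C1_compact \<Omega> f \<longleftrightarrow> C1 f \<and> (\<exists>K. compact K \<and> K \<subseteq> \<Omega> \<and> (\<forall>x. x \<notin> K \<longrightarrow> f x = 0))"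

definition gradient :: "(real^'n \<Rightarrow> real) \<Rightarrow> real^'n \<Rightarrow> real^'n" where
  "gradient \<psi> x = (\<chi> i. frechet_derivative \<psi> (at x) (axis i 1))"

definition divergence :: "(real^'n \<Rightarrow> real^'n) \<Rightarrow> real^'n \<Rightarrow> real" where
  "divergence \<phi> x = (\<Sum>i\<in>UNIV. frechet_derivative \<phi> (at x) (axis i 1) $ i)"


section \<open>Functions of bounded variation\<close>

definition total_variation :: "(real^'n) set \<Rightarrow> (real^'n \<Rightarrow> real) \<Rightarrow> ereal" where
  "total_variation \<Omega> w =
     (SUP \<phi> \<in> {\<phi>. C1_compact \<Omega> \<phi> \<and> (\<forall>x. norm (\<phi> x) \<le> 1)}.
        ereal (\<integral>x. w x * divergence \<phi> x \<partial>lebesgue_on \<Omega>))"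

definition BV :: "(real^'n) set \<Rightarrow> (real^'n \<Rightarrow> real) set" where
  "BV \<Omega> = {w. integrable (lebesgue_on \<Omega>) w \<and> total_variation \<Omega> w < \<infinity>}"


section \<open>Weak divergence and normal trace\<close>

definition has_weak_divergence ::
    "(real^'n) set \<Rightarrow> (real^'n \<Rightarrow> real^'n) \<Rightarrow> (real^'n \<Rightarrow> real) \<Rightarrow> bool" where
  "has_weak_divergence \<Omega> \<phi> g \<longleftrightarrow> (\<forall>\<psi>. C1_compact \<Omega> \<psi> \<longrightarrow>
     (\<integral>x. \<phi> x \<bullet> gradient \<psi> x \<partial>lebesgue_on \<Omega>) = - (\<integral>x. g x * \<psi> x \<partial>lebesgue_on \<Omega>))"

text \<open>
  For \<open>\<phi>\<close> in \<open>L\<^sup>2\<close> with weak divergence \<open>g\<close> in \<open>L\<^sup>2\<close>, the normal trace is by definition the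
  boundary functional given by Green's formula. Testing with \<open>C\<^sup>1\<close> functions on the whole
  space, whose restrictions are dense in \<open>H\<^sup>1(\<Omega>)\<close>, determines it on a bounded Lipschitz domain.
\<close>

definition normal_trace ::
    "(real^'n) set \<Rightarrow> (real^'n \<Rightarrow> real^'n) \<Rightarrow> (real^'n \<Rightarrow> real) \<Rightarrow> (real^'n \<Rightarrow> real) \<Rightarrow> real" where
  "normal_trace \<Omega> \<phi> g \<psi> =
     (\<integral>x. \<phi> x \<bullet> gradient \<psi> x \<partial>lebesgue_on \<Omega>) + (\<integral>x. g x * \<psi> x \<partial>lebesgue_on \<Omega>)"


section \<open>Axis-aligned grids\<close>

text \<open>
  Cells are taken open, so they partition the box up to a null set. The nodes in direction \<open>i\<close> are
  \<open>p i 0 < \<dots> < p i (N i)\<close>.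
\<close>

definition is_axis_grid :: "real^'n \<Rightarrow> real^'n \<Rightarrow> (real^'n) set set \<Rightarrow> bool" where
  "is_axis_grid a b \<Q> \<longleftrightarrow> (\<exists>(N :: 'n \<Rightarrow> nat) (p :: 'n \<Rightarrow> nat \<Rightarrow> real).
     (\<forall>i. p i 0 = a $ i \<and> p i (N i) = b $ i \<and> (\<forall>k < N i. p i k < p i (Suc k))) \<and>
     \<Q> = {box (\<chi> i. p i (K i)) (\<chi> i. p i (Suc (K i))) | K. \<forall>i. K i < N i})"

definition eccentricity_bounded_by :: "real \<Rightarrow> (real^'n) set set \<Rightarrow> bool" where
  "eccentricity_bounded_by \<kappa> \<Q> \<longleftrightarrow> (\<forall>Q\<in>\<Q>. \<exists>c r. Q \<subseteq> cball c r \<and>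
     measure lebesgue (cball c r) \<le> \<kappa> * measure lebesgue Q)"

definition cell_average :: "(real^'n) set set \<Rightarrow> (real^'n \<Rightarrow> real) \<Rightarrow> real^'n \<Rightarrow> real" where
  "cell_average \<Q> g x =
     (\<Sum>Q\<in>\<Q>. indicator Q x * (1 / measure lebesgue Q * (\<integral>y. g y \<partial>lebesgue_on Q)))"


section \<open>Raviart--Thomas fields and the discrete total variation\<close>

definition RT0_0 :: "(real^'n) set \<Rightarrow> (real^'n) set set \<Rightarrow> (real^'n \<Rightarrow> real^'n) set" where
  "RT0_0 \<Omega> \<Q> = {\<phi>. L2_on \<Omega> \<phi> \<and>
     (\<exists>g. L2_on \<Omega> g \<and> has_weak_divergence \<Omega> \<phi> g \<and> (\<forall>\<psi>. C1 \<psi> \<longrightarrow> normal_trace \<Omega> \<phi> g \<psi> = 0)) \<and>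
     (\<forall>Q\<in>\<Q>. \<exists>\<alpha> \<beta> :: real^'n. AE x in lebesgue_on Q. \<forall>i. \<phi> x $ i = \<alpha> $ i + \<beta> $ i * x $ i)}"

text \<open>
  The weak divergence \<open>g\<close> of \<open>\<phi>\<close> is unique up to null sets, so ranging over all its
  representatives does not change the supremum.
\<close>

definition TV_grid :: "(real^'n) set \<Rightarrow> (real^'n) set set \<Rightarrow> (real^'n \<Rightarrow> real) \<Rightarrow> ereal" where
  "TV_grid \<Omega> \<Q> w =
     (SUP (\<phi>, g) \<in> {(\<phi>, g). \<phi> \<in> RT0_0 \<Omega> \<Q> \<and> L2_on \<Omega> g \<and> has_weak_divergence \<Omega> \<phi> g \<and>
                       (AE x in lebesgue_on \<Omega>. norm (\<phi> x) \<le> 1)}.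
        ereal (\<integral>x. w x * g x \<partial>lebesgue_on \<Omega>))"

end

theory Submission
  imports Defs "HOL-Complex_Analysis.Great_Picard"
begin

text \<open>
  Write \<open>w\<close> for one of the step functions and fix a coordinate direction \<open>i\<close>. A Raviart--Thomas
  field whose only nonzero component is the \<open>i\<close>-th one is determined by its values on the interior
  facets orthogonal to \<open>e\<^sub>i\<close>: it is a combination of hat functions in \<open>x\<^sub>i\<close>, one for each such facet.
  The hats along a line of cells sum to at most one, so values in \<open>[-1, 1]\<close> on the facets give a field
  of length at most one. Choosing the values to be the signs of the jumps of \<open>w\<close> and testing \<open>w\<close>
  with the divergence shows that the sum of (jump of \<open>w\<close>) \<open>\<times>\<close> (area of the facet), over all facets
  orthogonal to \<open>e\<^sub>i\<close>, is at most \<open>TV\<^sub>\<tau>(w)\<close> (\<open>sum_jumps_le_TV_grid\<close>).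

  The jumps control translations: \<open>w(x + t e\<^sub>i) - w(x)\<close> is the sum of the jumps over the facets that the
  segment from \<open>x\<close> to \<open>x + t e\<^sub>i\<close> crosses, and the points \<open>x\<close> whose segment crosses a given facet form a
  box of measure \<open>\<bar>t\<bar>\<close> times its area. Hence the integral of \<open>\<bar>w(x + t e\<^sub>i) - w(x)\<bar>\<close>, over those \<open>x\<close>
  for which both points lie in \<open>\<Omega>\<close>, is at most \<open>C \<bar>t\<bar>\<close>
  (\<open>step_function_translation_bounded\<close>). This estimate is uniform along the sequence, and both
  claims follow from it.

  Compactness: averaging over a uniform coarse grid of width \<open>h\<close> changes \<open>w\<close> by \<open>O(h)\<close> in \<open>L\<^sup>1(\<Omega>)\<close>
  (\<open>uniform_average_error\<close>), and on each coarse grid there are finitely many averages, which the \<open>L\<^sup>1\<close>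
  bound keeps bounded. A diagonal subsequence makes all of them converge for all coarse grids at
  once, and along it the functions are Cauchy in \<open>L\<^sup>1\<close> (\<open>translation_bounded_compact\<close>).

  Bounded variation: in \<open>\<integral> w \<partial>\<^sub>i f\<close>, replace \<open>\<partial>\<^sub>i f\<close> by a difference quotient and shift it to \<open>w\<close>. The
  translation estimate bounds the result by \<open>C\<close> whenever \<open>\<bar>f\<bar> \<le> 1\<close> (\<open>translation_bounded_weak_partial\<close>), and
  the bound passes to \<open>L\<^sup>1\<close> limits (\<open>BV_of_translation_bounded_limit\<close>).

  Integration by parts for the hat fields uses the same device: the integral of
  \<open>F(x + t e\<^sub>i) - F(x)\<close> vanishes by translation invariance, and dividing by \<open>t\<close> and letting \<open>t\<close> tend
  to \<open>0\<close> gives Green's formula on all of \<open>\<Omega>\<close> at once (\<open>integral_by_parts_Lipschitz\<close>).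
\<close>

section \<open>Boxes and coordinate hyperplanes\<close>

lemma prod_Basis_vec: "(\<Prod>b\<in>(Basis :: (real^'n) set). f b) = (\<Prod>i\<in>UNIV. f (axis i 1))"
proof -
  have B: "(Basis :: (real^'n) set) = range (\<lambda>i. axis i 1)"
    by (auto simp: Basis_vec_def)
  show ?thesis
    unfolding B by (subst prod.reindex) (auto simp: inj_on_def axis_eq_axis)
qed

lemma measure_lborel_box_vec:
  assumes "\<And>i. l $ i \<le> u $ i"
  shows "measure lborel (box l u) = (\<Prod>i\<in>UNIV. u $ i - l $ i :: real)"
proof -
  have "\<forall>b\<in>Basis. l \<bullet> b \<le> u \<bullet> b"
    using assms by (auto simp: Basis_vec_def inner_axis)
  hence "measure lborel (box l u) = (\<Prod>b\<in>Basis. (u - l) \<bullet> b)"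
    unfolding measure_lborel_box_eq by (rule if_P)
  thus ?thesis
    by (simp only: prod_Basis_vec inner_axis vector_minus_component inner_real_def mult_1_right)
qed

lemma emeasure_lborel_box_vec:
  assumes "\<And>i. l $ i \<le> u $ i"
  shows "emeasure lborel (box l u) = ennreal (\<Prod>i\<in>UNIV. u $ i - l $ i :: real)"
  using measure_lborel_box_vec[OF assms] emeasure_lborel_box_finite[of l u]
  by (simp add: emeasure_eq_ennreal_measure)

lemma AE_coord_neq: "AE x in lborel. (x :: real^'n) $ i \<noteq> c"
proof -
  have "{x :: real^'n. x $ i = c} \<in> null_sets lebesgue"
    using negligible_standard_hyperplane[of "axis i 1 :: real^'n" c]
    by (simp add: negligible_iff_null_sets cart_eq_inner_axis)
  hence "AE x in lebesgue. (x :: real^'n) \<notin> {x. x $ i = c}"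
    by (rule AE_not_in)
  hence "AE x in lborel. (x :: real^'n) \<notin> {x. x $ i = c}"
    by (simp only: AE_completion_iff)
  thus ?thesis by simp
qed

section \<open>Grids and step functions\<close>

text \<open>
  A cell is addressed by the multi-index \<open>K\<close> of its lower corner. The same locale serves for the
  given grids and for the uniform grids of the compactness argument.
\<close>

locale axis_grid =
  fixes a b :: "real^'n" and N :: "'n \<Rightarrow> nat" and p :: "'n \<Rightarrow> nat \<Rightarrow> real"
  assumes first_node: "p i 0 = a $ i" and last_node: "p i (N i) = b $ i"
    and node_step: "k < N i \<Longrightarrow> p i k < p i (Suc k)"
begin

definition indices :: "('n \<Rightarrow> nat) set" where
  "indices = {K. \<forall>i. K i < N i}"

definition cell :: "('n \<Rightarrow> nat) \<Rightarrow> (real^'n) set" where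
  "cell K = box (\<chi> i. p i (K i)) (\<chi> i. p i (Suc (K i)))"

definition step_function :: "(('n \<Rightarrow> nat) \<Rightarrow> real) \<Rightarrow> real^'n \<Rightarrow> real" where
  "step_function c x = (\<Sum>K\<in>indices. c K * indicator (cell K) x)"

lemma finite_indices [simp]: "finite indices"
proof -
  have "indices \<subseteq> (\<Pi>\<^sub>E i\<in>UNIV. {..<N i})"
    by (auto simp: indices_def)
  thus ?thesis by (rule finite_subset) (auto intro: finite_PiE)
qed

lemma mem_cell: "x \<in> cell K \<longleftrightarrow> (\<forall>i. p i (K i) < x $ i \<and> x $ i < p i (Suc (K i)))"
  by (auto simp: cell_def mem_box_cart)

lemma cell_borel [measurable, simp]: "cell K \<in> sets borel"
  by (simp add: cell_def)

lemma node_mono: "j \<le> k \<Longrightarrow> k \<le> N i \<Longrightarrow> p i j \<le> p i k"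
proof (induction k)
  case (Suc k)
  show ?case
  proof (cases "j = Suc k")
    case False
    thus ?thesis using Suc node_step[of k i] by fastforce
  qed simp
qed simp

lemma interval_index_unique:
  assumes "j < N i" "k < N i" "p i j < t" "t < p i (Suc j)" "p i k < t" "t < p i (Suc k)"
  shows "j = k"
proof (rule ccontr)
  assume "j \<noteq> k"
  then consider "Suc j \<le> k" | "Suc k \<le> j" by linarith
  thus False
    using node_mono[of "Suc j" k i] node_mono[of "Suc k" j i] assms by cases auto
qed

lemma cell_unique: "K \<in> indices \<Longrightarrow> L \<in> indices \<Longrightarrow> x \<in> cell K \<Longrightarrow> x \<in> cell L \<Longrightarrow> K = L"
  by (rule ext, rule interval_index_unique) (auto simp: indices_def mem_cell)

lemma step_function_cell:
  assumes "K \<in> indices" "x \<in> cell K"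
  shows "step_function c x = c K"
proof -
  have "c L * indicator (cell L) x = (if L = K then c K else 0)" if "L \<in> indices" for L
  proof (cases "L = K")
    case False
    hence "x \<notin> cell L" using cell_unique[OF that assms(1) _ assms(2)] by metis
    thus ?thesis using False by simp
  qed (use assms(2) in simp)
  thus ?thesis
    unfolding step_function_def using assms by simp
qed

lemma step_function_measurable [measurable]: "step_function c \<in> borel_measurable borel"
  unfolding step_function_def by measurable

lemma cell_subset: "K \<in> indices \<Longrightarrow> cell K \<subseteq> box a b"
proof
  fix x assume K: "K \<in> indices" "x \<in> cell K"
  { fix i
    have "K i < N i" using K by (auto simp: indices_def)
    hence "a $ i \<le> p i (K i)" "p i (Suc (K i)) \<le> b $ i"
      using node_mono[of 0 "K i" i] node_mono[of "Suc (K i)" "N i" i] by (auto simp: first_node last_node)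
    moreover have "p i (K i) < x $ i" "x $ i < p i (Suc (K i))"
      using K by (auto simp: mem_cell)
    ultimately have "a $ i < x $ i \<and> x $ i < b $ i" by linarith }
  thus "x \<in> box a b" by (auto simp: mem_box_cart)
qed

lemma interval_index_exists:
  assumes "a $ i < t" "t < b $ i" "\<And>k. k \<le> N i \<Longrightarrow> t \<noteq> p i k"
  shows "\<exists>k<N i. p i k < t \<and> t < p i (Suc k)"
proof -
  have ex: "\<exists>k. k \<le> N i \<and> t < p i k"
    using assms by (intro exI[of _ "N i"]) (auto simp: last_node)
  define m where "m = (LEAST k. k \<le> N i \<and> t < p i k)"
  have m: "m \<le> N i" "t < p i m"
    using LeastI_ex[OF ex] by (auto simp: m_def)
  have "m \<noteq> 0" using m(2) assms(1) first_node[of i] by (intro notI) simp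
  then obtain k where k: "m = Suc k" by (cases m) auto
  have "\<not> (k \<le> N i \<and> t < p i k)"
    using not_less_Least[of k "\<lambda>k. k \<le> N i \<and> t < p i k"] k by (simp add: m_def)
  hence "p i k < t" using m(1) k assms(3)[of k] by auto
  thus ?thesis using m k by (intro exI[of _ k]) simp
qed

lemma cell_exists:
  assumes "x \<in> box a b" "\<And>i k. k \<le> N i \<Longrightarrow> x $ i \<noteq> p i k"
  shows "\<exists>K\<in>indices. x \<in> cell K"
proof -
  have "\<forall>i. \<exists>k<N i. p i k < x $ i \<and> x $ i < p i (Suc k)"
    using assms by (intro allI interval_index_exists) (auto simp: mem_box_cart)
  then obtain K where "\<And>i. K i < N i \<and> p i (K i) < x $ i \<and> x $ i < p i (Suc (K i))"
    by metis
  thus ?thesis by (intro bexI[of _ K]) (auto simp: mem_cell indices_def)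
qed

text \<open>
  Cells are open, so the points on cell boundaries belong to none of them. They lie on
  countably many coordinate hyperplanes.
\<close>

lemma AE_off_nodes: "AE x in lborel. \<forall>i. \<forall>k. (x :: real^'n) $ i \<noteq> p i k"
  by (simp add: AE_all_countable AE_coord_neq)

lemma AE_cell_exists: "AE x in lborel. x \<in> box a b \<longrightarrow> (\<exists>K\<in>indices. x \<in> cell K)"
  using AE_off_nodes
proof eventually_elim
  case (elim x)
  thus ?case using cell_exists[of x] by simp
qed

lemma cell_width_pos: "K \<in> indices \<Longrightarrow> p i (K i) < p i (Suc (K i))"
  using node_step by (auto simp: indices_def)

lemma measure_cell:
  assumes "K \<in> indices"
  shows "measure lborel (cell K) = (\<Prod>i\<in>UNIV. p i (Suc (K i)) - p i (K i))"
  using cell_width_pos[OF assms] unfolding cell_def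
  by (subst measure_lborel_box_vec) (auto simp: less_imp_le)

lemma measure_cell_pos: "K \<in> indices \<Longrightarrow> 0 < measure lborel (cell K)"
  using cell_width_pos by (auto simp: measure_cell intro!: prod_pos)

lemma emeasure_cell_finite: "emeasure lborel (cell K) < \<infinity>"
  unfolding cell_def by (rule emeasure_lborel_box_finite)

lemma cell_nonempty: "K \<in> indices \<Longrightarrow> cell K \<noteq> {}"
  using measure_cell_pos[of K] by auto

lemma inj_on_cell: "inj_on cell indices"
  by (rule inj_onI) (metis cell_nonempty cell_unique ex_in_conv)

end

section \<open>Integration by parts through translations\<close>

abbreviation partial :: "'n \<Rightarrow> (real^'n \<Rightarrow> real) \<Rightarrow> real^'n \<Rightarrow> real" where
  "partial i \<psi> x \<equiv> frechet_derivative \<psi> (at x) (axis i 1)"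

lemma nn_integral_lborel_translate:
  fixes c :: "'a::euclidean_space"
  assumes [measurable]: "f \<in> borel_measurable borel"
  shows "(\<integral>\<^sup>+x. f (x + c) \<partial>lborel) = (\<integral>\<^sup>+x. f x \<partial>lborel)"
  by (subst (2) lborel_distr_plus[of c, symmetric], subst nn_integral_distr) (simp_all add: add.commute)

lemma integral_lborel_translate:
  fixes c :: "'a::euclidean_space" and f :: "'a \<Rightarrow> real"
  assumes [measurable]: "f \<in> borel_measurable borel"
  shows "(\<integral>x. f (x + c) \<partial>lborel) = (\<integral>x. f x \<partial>lborel)"
  by (subst (2) lborel_distr_plus[of c, symmetric], subst integral_distr) (simp_all add: add.commute)

lemma integrable_lborel_translate:
  fixes c :: "'a::euclidean_space" and f :: "'a \<Rightarrow> real"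
  assumes "integrable lborel f"
  shows "integrable lborel (\<lambda>x. f (x + c))"
proof -
  have "integrable (distr lborel borel ((+) c)) f"
    using assms by (simp add: lborel_distr_plus)
  thus ?thesis
    using assms by (subst (asm) integrable_distr_eq) (auto simp: add.commute)
qed

lemma axis_eq_scaleR: "axis i t = t *\<^sub>R (axis i 1 :: real^'n)"
  by (simp add: vec_eq_iff axis_def)

lemma axis_zero: "axis i 0 = (0 :: real^'n)"
  by (simp add: vec_eq_iff axis_def)

lemma norm_axis_real: "norm (axis i t :: real^'n) = \<bar>t\<bar>"
  by (subst axis_eq_scaleR) (simp add: norm_axis_1)

lemma integrable_indicator_cball: "integrable lborel (indicator (cball c r) :: 'a::euclidean_space \<Rightarrow> real)"
  using emeasure_lborel_cball_finite[of c r] by (intro integrable_real_indicator) auto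

lemma integrable_bounded_support:
  fixes f :: "'a::euclidean_space \<Rightarrow> real"
  assumes [measurable]: "f \<in> borel_measurable borel"
    and bound: "\<And>x. norm x \<le> R \<Longrightarrow> \<bar>f x\<bar> \<le> B" and support: "\<And>x. f x \<noteq> 0 \<Longrightarrow> norm x \<le> R"
  shows "integrable lborel f"
proof (rule Bochner_Integration.integrable_bound)
  show "integrable lborel (\<lambda>x. B * indicator (cball 0 R :: 'a set) x)"
    by (intro integrable_mult_right integrable_indicator_cball)
  show "AE x in lborel. norm (f x) \<le> norm (B * indicator (cball 0 R) x)"
  proof (rule AE_I2)
    fix x show "norm (f x) \<le> norm (B * indicator (cball 0 R) x)"
      using bound[of x] support[of x] by (cases "f x = 0") auto
  qed
qed auto

lemma C1_has_derivative:
  assumes "C1 f" shows "(f has_derivative frechet_derivative f (at x)) (at x)"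
  using assms by (auto simp: C1_def differentiable_on_def frechet_derivative_works)

lemma C1_continuous: "C1 f \<Longrightarrow> continuous_on UNIV f"
  by (auto simp: C1_def differentiable_imp_continuous_on)

lemma C1_measurable: "C1 f \<Longrightarrow> f \<in> borel_measurable borel"
  by (intro borel_measurable_continuous_onI C1_continuous)

lemma C1_partial_continuous: "C1 \<psi> \<Longrightarrow> continuous_on UNIV (partial i \<psi>)"
  by (auto simp: C1_def)

lemma C1_partial_measurable: "C1 \<psi> \<Longrightarrow> partial i \<psi> \<in> borel_measurable borel"
  by (intro borel_measurable_continuous_onI C1_partial_continuous)

lemma C1_has_partial:
  fixes \<psi> :: "real^'n \<Rightarrow> real"
  assumes "C1 \<psi>"
  shows "((\<lambda>t. \<psi> (x + axis i t)) has_real_derivative partial i \<psi> (x + axis i s)) (at s)"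
proof -
  have "((\<lambda>t. \<psi> (x + t *\<^sub>R axis i 1)) has_derivative
      (\<lambda>h. frechet_derivative \<psi> (at (x + s *\<^sub>R axis i 1)) (h *\<^sub>R axis i 1))) (at s)"
    by (rule has_derivative_compose[OF _ C1_has_derivative[OF assms]])
      (auto intro!: derivative_eq_intros)
  moreover have "linear (frechet_derivative \<psi> (at (x + s *\<^sub>R axis i 1)))"
    using C1_has_derivative[OF assms] has_derivative_linear by blast
  moreover have "(\<lambda>t. \<psi> (x + axis i t)) = (\<lambda>t. \<psi> (x + t *\<^sub>R axis i 1))"
    by (rule ext, subst axis_eq_scaleR) (rule refl)
  moreover have "x + axis i s = x + s *\<^sub>R axis i 1"
    by (subst axis_eq_scaleR) (rule refl)
  ultimately show ?thesis
    unfolding has_field_derivative_def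
    by (simp add: linear_cmul mult.commute[of _ "frechet_derivative _ _ _"])
qed

lemma C1_difference_quotient:
  fixes \<psi> :: "real^'n \<Rightarrow> real"
  assumes "C1 \<psi>"
  shows "(\<lambda>k. (\<psi> (x + axis i (1 / real (Suc k))) - \<psi> x) * real (Suc k)) \<longlonglongrightarrow> partial i \<psi> x"
proof -
  have "((\<lambda>t. (\<psi> (x + axis i (0 + t)) - \<psi> (x + axis i 0)) / t) \<longlongrightarrow> partial i \<psi> (x + axis i 0)) (at 0)"
    using C1_has_partial[OF assms, of x i 0] unfolding DERIV_def .
  hence "((\<lambda>t. (\<psi> (x + axis i t) - \<psi> x) / t) \<longlongrightarrow> partial i \<psi> x) (at 0)"
    by (simp add: axis_zero)
  moreover have "filterlim (\<lambda>k. 1 / real (Suc k)) (at 0) sequentially"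
    unfolding filterlim_at using LIMSEQ_inverse_real_of_nat by (auto simp: inverse_eq_divide)
  ultimately have "(\<lambda>k. (\<psi> (x + axis i (1 / real (Suc k))) - \<psi> x) / (1 / real (Suc k))) \<longlonglongrightarrow> partial i \<psi> x"
    by (rule filterlim_compose)
  thus ?thesis by (simp only: divide_divide_eq_right div_by_1)
qed

text \<open>
  Uniform bounds on a ball for \<open>\<psi>\<close>, its derivative and its difference quotients; they supply the
  majorants for dominated convergence.
\<close>

lemma C1_bounds:
  fixes \<psi> :: "real^'n \<Rightarrow> real"
  assumes "C1 \<psi>"
  obtains M where "0 \<le> M" "\<And>x. norm x \<le> R \<Longrightarrow> \<bar>\<psi> x\<bar> \<le> M" "\<And>x. norm x \<le> R \<Longrightarrow> \<bar>partial i \<psi> x\<bar> \<le> M"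
    "\<And>x t. norm x \<le> R \<Longrightarrow> 0 \<le> t \<Longrightarrow> t \<le> 1 \<Longrightarrow> \<bar>\<psi> (x + axis i t)\<bar> \<le> M"
    "\<And>x t. norm x \<le> R \<Longrightarrow> 0 \<le> t \<Longrightarrow> t \<le> 1 \<Longrightarrow> \<bar>\<psi> (x + axis i t) - \<psi> x\<bar> \<le> M * t"
proof -
  let ?B = "cball (0 :: real^'n) (R + 1)"
  have sup_on_ball: "\<exists>m. \<forall>x. norm x \<le> R + 1 \<longrightarrow> \<bar>f x\<bar> \<le> m" if "continuous_on UNIV f" for f :: "real^'n \<Rightarrow> real"
  proof -
    have "compact (f ` ?B)"
      by (intro compact_continuous_image continuous_on_subset[OF that]) auto
    from compact_imp_bounded[OF this] obtain m where "\<forall>y\<in>f ` ?B. norm y \<le> m"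
      unfolding bounded_iff by blast
    thus ?thesis by (intro exI[of _ m]) simp
  qed
  obtain M1 M2 where M1: "\<And>x. norm x \<le> R + 1 \<Longrightarrow> \<bar>\<psi> x\<bar> \<le> M1"
    and M2: "\<And>x. norm x \<le> R + 1 \<Longrightarrow> \<bar>partial i \<psi> x\<bar> \<le> M2"
    using sup_on_ball[OF C1_continuous[OF assms]] sup_on_ball[OF C1_partial_continuous[OF assms, of i]] by metis
  define M where "M = max 0 (max M1 M2)"
  have shift: "norm (x + axis i t) \<le> R + 1" if "norm x \<le> R" "0 \<le> t" "t \<le> 1" for x :: "real^'n" and t
    using norm_triangle_ineq[of x "axis i t"] that by (simp add: norm_axis_real)
  have lip: "\<bar>\<psi> (x + axis i t) - \<psi> x\<bar> \<le> M * t" if x: "norm x \<le> R" and t: "0 \<le> t" "t \<le> 1" for x t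
  proof (cases "t = 0")
    case True thus ?thesis by (simp add: axis_zero)
  next
    case False
    hence "0 < t" using t by simp
    then obtain z where z: "0 < z" "z < t"
      "\<psi> (x + axis i t) - \<psi> (x + axis i 0) = (t - 0) * partial i \<psi> (x + axis i z)"
      using MVT2[of 0 t "\<lambda>t. \<psi> (x + axis i t)" "\<lambda>s. partial i \<psi> (x + axis i s)"]
        C1_has_partial[OF assms] by blast
    have "\<bar>partial i \<psi> (x + axis i z)\<bar> \<le> M"
      using M2[OF shift[OF x, of z]] z t by (simp add: M_def)
    hence "\<bar>t * partial i \<psi> (x + axis i z)\<bar> \<le> t * M"
      using t by (simp add: abs_mult mult_left_mono)
    thus ?thesis using z(3) by (simp add: axis_zero mult.commute)
  qed
  show ?thesis
  proof (rule that[of M, OF _ _ _ _ lip])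
    show "\<bar>\<psi> x\<bar> \<le> M" "\<bar>partial i \<psi> x\<bar> \<le> M" if "norm x \<le> R" for x
      using M1[of x] M2[of x] that by (auto simp: M_def)
    show "\<bar>\<psi> (x + axis i t)\<bar> \<le> M" if "norm x \<le> R" "0 \<le> t" "t \<le> 1" for x t
      using M1[OF shift[OF that]] by (simp add: M_def)
  qed (auto simp: M_def)
qed

text \<open>
  With \<open>F = u \<psi>\<close>, the difference quotients of \<open>F\<close> in direction \<open>i\<close> have integral zero by translation
  invariance, and they converge almost everywhere to \<open>u \<partial>\<^sub>i\<psi> + g \<psi>\<close>. Since \<open>u\<close> vanishes outside a
  ball, boundary terms are already accounted for: in the application \<open>u\<close> is a Raviart--Thomas
  component extended by zero, and the vanishing normal trace makes the extension Lipschitz in \<open>x\<^sub>i\<close>.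
\<close>

lemma integral_by_parts_Lipschitz:
  fixes u g \<psi> :: "real^'n \<Rightarrow> real"
  assumes [measurable]: "u \<in> borel_measurable borel" "g \<in> borel_measurable borel"
    and support: "\<And>x. u x \<noteq> 0 \<Longrightarrow> norm x \<le> R"
    and bound: "\<And>x. \<bar>u x\<bar> \<le> B"
    and lip: "\<And>x t. 0 \<le> t \<Longrightarrow> \<bar>u (x + axis i t) - u x\<bar> \<le> L * t"
    and deriv: "AE x in lborel. (\<lambda>k. (u (x + axis i (1 / real (Suc k))) - u x) * real (Suc k)) \<longlonglongrightarrow> g x"
    and \<psi>: "C1 \<psi>"
  shows "(\<integral>x. u x * partial i \<psi> x + g x * \<psi> x \<partial>lborel) = 0"
proof -
  note [measurable] = C1_measurable[OF \<psi>] C1_partial_measurable[OF \<psi>]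
  define h where "h k = 1 / real (Suc k)" for k
  have h: "0 < h k" "h k \<le> 1" for k by (auto simp: h_def)
  define F where "F x = u x * \<psi> x" for x
  have [measurable]: "F \<in> borel_measurable borel" unfolding F_def by measurable
  define D where "D k x = (F (x + axis i (h k)) - F x) * real (Suc k)" for k x
  have [measurable]: "D k \<in> borel_measurable borel" for k unfolding D_def by measurable
  obtain M where M: "0 \<le> M" "\<And>x t. norm x \<le> R + 1 \<Longrightarrow> 0 \<le> t \<Longrightarrow> t \<le> 1 \<Longrightarrow> \<bar>\<psi> (x + axis i t)\<bar> \<le> M"
    "\<And>x t. norm x \<le> R + 1 \<Longrightarrow> 0 \<le> t \<Longrightarrow> t \<le> 1 \<Longrightarrow> \<bar>\<psi> (x + axis i t) - \<psi> x\<bar> \<le> M * t"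
    "\<And>x. norm x \<le> R + 1 \<Longrightarrow> \<bar>\<psi> x\<bar> \<le> M"
    by (rule C1_bounds[OF \<psi>, of "R + 1" i]) blast
  have B0: "0 \<le> B" using bound[of 0] by linarith
  have L0: "0 \<le> L" using lip[of 1 0] by simp
  have int_F: "integrable lborel F"
  proof (rule integrable_bounded_support[where R = R and B = "B * M"])
    show "\<bar>F x\<bar> \<le> B * M" if "norm x \<le> R" for x
      unfolding F_def abs_mult using that bound[of x] M(4)[of x] B0 by (intro mult_mono) auto
  qed (use support in \<open>auto simp: F_def\<close>)
  have int_D: "(\<integral>x. D k x \<partial>lborel) = 0" for k
    unfolding D_def
    by (simp add: int_F integrable_lborel_translate integral_lborel_translate)
  \<comment> \<open>Leibniz rule for difference quotients; the two terms are bounded separately.\<close>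
  have split: "D k x = (u (x + axis i (h k)) - u x) * real (Suc k) * \<psi> (x + axis i (h k))
      + u x * ((\<psi> (x + axis i (h k)) - \<psi> x) * real (Suc k))" for k x
    by (simp add: D_def F_def algebra_simps)
  have "(\<lambda>k. \<integral>x. D k x \<partial>lborel) \<longlonglongrightarrow> (\<integral>x. u x * partial i \<psi> x + g x * \<psi> x \<partial>lborel)"
  proof (rule integral_dominated_convergence[where w = "\<lambda>x. (L * M + B * M) * indicator (cball 0 (R + 1)) x"])
    show "integrable lborel (\<lambda>x. (L * M + B * M) * indicator (cball 0 (R + 1)) x :: real)"
      by (intro integrable_mult_right integrable_indicator_cball)
    show "AE x in lborel. norm (D k x) \<le> (L * M + B * M) * indicator (cball 0 (R + 1)) x" for k
    proof (rule AE_I2)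
      fix x
      show "norm (D k x) \<le> (L * M + B * M) * indicator (cball 0 (R + 1)) x"
      proof (cases "norm x \<le> R + 1")
        case True
        have "\<bar>(u (x + axis i (h k)) - u x) * real (Suc k)\<bar> \<le> L * h k * real (Suc k)"
          unfolding abs_mult using lip[of "h k" x] h[of k] by (intro mult_mono) auto
        hence 1: "\<bar>(u (x + axis i (h k)) - u x) * real (Suc k)\<bar> \<le> L" by (simp add: h_def)
        have "\<bar>(\<psi> (x + axis i (h k)) - \<psi> x) * real (Suc k)\<bar> \<le> M * h k * real (Suc k)"
          unfolding abs_mult using M(3)[of x "h k"] True h[of k] by (intro mult_mono) auto
        hence 2: "\<bar>(\<psi> (x + axis i (h k)) - \<psi> x) * real (Suc k)\<bar> \<le> M" by (simp add: h_def)
        have "\<bar>D k x\<bar> \<le> L * M + B * M"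
          unfolding split
          by (intro order_trans[OF abs_triangle_ineq] add_mono; subst abs_mult; intro mult_mono)
            (use 1 2 M(2)[of x "h k"] h[of k] True bound[of x] L0 B0 in auto)
        thus ?thesis using True by simp
      next
        case False
        have "norm x \<le> norm (x + axis i (h k)) + h k"
          using norm_triangle_ineq4[of "x + axis i (h k)" "axis i (h k)"] h[of k] by (simp add: norm_axis_real)
        hence "u (x + axis i (h k)) = 0" "u x = 0"
          using support[of x] support[of "x + axis i (h k)"] False h[of k] by force+
        thus ?thesis by (simp add: D_def F_def indicator_def False)
      qed
    qed
    show "AE x in lborel. (\<lambda>k. D k x) \<longlonglongrightarrow> u x * partial i \<psi> x + g x * \<psi> x"
      using deriv
    proof eventually_elim
      case (elim x)
      have "isCont (\<lambda>t. \<psi> (x + axis i t)) 0"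
        using C1_has_partial[OF \<psi>] DERIV_isCont by blast
      moreover have "h \<longlonglongrightarrow> 0"
        unfolding h_def using LIMSEQ_inverse_real_of_nat by (simp add: inverse_eq_divide)
      ultimately have "(\<lambda>k. \<psi> (x + axis i (h k))) \<longlonglongrightarrow> \<psi> (x + axis i 0)"
        by (rule isCont_tendsto_compose)
      hence "(\<lambda>k. \<psi> (x + axis i (h k))) \<longlonglongrightarrow> \<psi> x"
        by (simp add: axis_zero)
      from tendsto_add[OF tendsto_mult[OF elim this] tendsto_mult[OF tendsto_const C1_difference_quotient[OF \<psi>, of x i], of "u x"]]
      show ?case
        unfolding split h_def by (simp add: add.commute)
    qed
  qed auto
  thus ?thesis unfolding int_D using LIMSEQ_unique tendsto_const by blast
qed

text \<open>
  An anisotropic form of the characterisation of \<open>BV\<close> by translations. Both endpoints are required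
  to lie in \<open>\<Omega>\<close>, since nothing is known about the size of the jump at \<open>\<partial>\<Omega>\<close> of the extension by zero.
\<close>

definition translation_bounded :: "(real^'n) set \<Rightarrow> real \<Rightarrow> (real^'n \<Rightarrow> real) \<Rightarrow> bool" where
  "translation_bounded \<Omega> C w \<longleftrightarrow> (\<forall>i t. (\<integral>\<^sup>+x. indicator \<Omega> x * indicator \<Omega> (x + axis i t) *
     ennreal \<bar>w (x + axis i t) - w x\<bar> \<partial>lborel) \<le> ennreal (C * \<bar>t\<bar>))"

text \<open>
  The difference quotient of \<open>f\<close> is moved to \<open>w\<close> by a change of variables. As \<open>f\<close> is supported in a
  compact subset of \<open>\<Omega>\<close>, a small shift of its support stays in \<open>\<Omega>\<close>, where the translation
  estimate applies.
\<close>

lemma translation_bounded_weak_partial: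
  fixes w f :: "real^'n \<Rightarrow> real"
  assumes w: "integrable lborel w" and tb: "translation_bounded \<Omega> C w" and "0 \<le> C"
    and \<Omega>: "open \<Omega>" and f: "C1 f" "\<And>x. \<bar>f x\<bar> \<le> 1"
    and K: "compact K" "K \<subseteq> \<Omega>" "\<And>x. x \<notin> K \<Longrightarrow> f x = 0"
  shows "integrable lborel (\<lambda>x. w x * partial i f x)" "(\<integral>x. w x * partial i f x \<partial>lborel) \<le> C"
proof -
  have [measurable]: "w \<in> borel_measurable borel" using w by auto
  have [measurable]: "\<Omega> \<in> sets borel" using \<Omega> by auto
  note [measurable] = C1_measurable[OF f(1)] C1_partial_measurable[OF f(1)]
  define h where "h k = 1 / real (Suc k)" for k
  have h: "0 < h k" "h k \<le> 1" for k by (auto simp: h_def)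
  obtain R where R: "\<And>x. x \<in> K \<Longrightarrow> norm x \<le> R"
    using compact_imp_bounded[OF K(1)] by (auto simp: bounded_iff)
  obtain M where M: "0 \<le> M" "\<And>x t. norm x \<le> R + 1 \<Longrightarrow> 0 \<le> t \<Longrightarrow> t \<le> 1 \<Longrightarrow> \<bar>f (x + axis i t) - f x\<bar> \<le> M * t"
    by (rule C1_bounds[OF f(1), of "R + 1" i]) blast
  have lip: "\<bar>f (x + axis i (h k)) - f x\<bar> \<le> M * h k" for x k
  proof (cases "norm x \<le> R + 1")
    case True thus ?thesis using M(2)[of x "h k"] h[of k] by simp
  next
    case False
    have "norm x \<le> norm (x + axis i (h k)) + h k"
      using norm_triangle_ineq4[of "x + axis i (h k)" "axis i (h k)"] h[of k] by (simp add: norm_axis_real)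
    hence "x \<notin> K" "x + axis i (h k) \<notin> K"
      using R[of x] R[of "x + axis i (h k)"] False h[of k] by force+
    thus ?thesis using K(3) M(1) h[of k] by simp
  qed
  define D where "D k x = w x * ((f (x + axis i (h k)) - f x) * real (Suc k))" for k x
  have [measurable]: "D k \<in> borel_measurable borel" for k unfolding D_def by measurable
  have DM: "\<bar>D k x\<bar> \<le> M * \<bar>w x\<bar>" for k x
  proof -
    have "\<bar>(f (x + axis i (h k)) - f x) * real (Suc k)\<bar> \<le> M * h k * real (Suc k)"
      unfolding abs_mult using lip[of x k] h[of k] by (intro mult_mono) auto
    hence "\<bar>(f (x + axis i (h k)) - f x) * real (Suc k)\<bar> \<le> M" by (simp add: h_def)
    hence "\<bar>w x\<bar> * \<bar>(f (x + axis i (h k)) - f x) * real (Suc k)\<bar> \<le> \<bar>w x\<bar> * M"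
      by (rule mult_left_mono) simp
    thus ?thesis by (simp only: D_def abs_mult mult.commute)
  qed
  have lim: "AE x in lborel. (\<lambda>k. D k x) \<longlonglongrightarrow> w x * partial i f x"
    unfolding D_def h_def by (intro AE_I2 tendsto_mult tendsto_const C1_difference_quotient[OF f(1)])
  have bnd: "AE x in lborel. norm (D k x) \<le> M * \<bar>w x\<bar>" for k
    by (intro AE_I2) (use DM in simp)
  have dom: "integrable lborel (\<lambda>x. M * \<bar>w x\<bar>)" using w by simp
  show "integrable lborel (\<lambda>x. w x * partial i f x)"
    by (rule integrable_dominated_convergence[OF _ _ dom lim bnd]) auto
  have conv: "(\<lambda>k. \<integral>x. D k x \<partial>lborel) \<longlonglongrightarrow> (\<integral>x. w x * partial i f x \<partial>lborel)"
    by (rule integral_dominated_convergence[OF _ _ dom lim bnd]) auto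
  obtain \<delta> where \<delta>: "\<delta> > 0" "(\<Union>x\<in>K. cball x \<delta>) \<subseteq> \<Omega>"
    using compact_subset_open_imp_cball_epsilon_subset[OF K(1) \<Omega> K(2)] by blast
  have int_wf: "integrable lborel (\<lambda>x. w x * f x)"
    by (rule Bochner_Integration.integrable_bound[OF w])
      (auto simp: abs_mult intro!: mult_left_le f(2))
  have int_wft: "integrable lborel (\<lambda>x. w x * f (x + c))" for c
    by (rule Bochner_Integration.integrable_bound[OF w])
      (auto simp: abs_mult intro!: mult_left_le f(2))
  have D_le: "(\<integral>x. D k x \<partial>lborel) \<le> C" if k: "h k < \<delta>" for k
  proof -
    let ?c = "axis i (h k)"
    let ?G = "\<lambda>x. (w x - w (x + ?c)) * f (x + ?c)"
    have int_G: "integrable lborel ?G"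
      using int_wft[of ?c] integrable_lborel_translate[OF int_wf, of ?c] by (simp add: left_diff_distrib)
    have "(\<integral>x. D k x \<partial>lborel) = (\<integral>x. (w x * f (x + ?c) - w x * f x) * real (Suc k) \<partial>lborel)"
      by (simp add: D_def algebra_simps)
    also have "\<dots> = ((\<integral>x. w x * f (x + ?c) \<partial>lborel) - (\<integral>x. w x * f x \<partial>lborel)) * real (Suc k)"
      by (simp add: int_wf int_wft)
    also have "(\<integral>x. w x * f x \<partial>lborel) = (\<integral>x. w (x + ?c) * f (x + ?c) \<partial>lborel)"
      by (subst integral_lborel_translate[of "\<lambda>x. w x * f x" ?c, symmetric]) auto
    also have "(\<integral>x. w x * f (x + ?c) \<partial>lborel) - \<dots> = (\<integral>x. ?G x \<partial>lborel)"
      by (subst Bochner_Integration.integral_diff[symmetric])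
        (use int_wft[of ?c] integrable_lborel_translate[OF int_wf, of ?c] in \<open>auto simp: left_diff_distrib\<close>)
    finally have eq: "(\<integral>x. D k x \<partial>lborel) = (\<integral>x. ?G x \<partial>lborel) * real (Suc k)" .
    have "ennreal (norm (\<integral>x. ?G x \<partial>lborel)) \<le> (\<integral>\<^sup>+x. norm (?G x) \<partial>lborel)"
      by (rule integral_norm_bound_ennreal[OF int_G])
    also have "\<dots> \<le> (\<integral>\<^sup>+x. indicator \<Omega> x * indicator \<Omega> (x + ?c) * ennreal \<bar>w (x + ?c) - w x\<bar> \<partial>lborel)"
    proof (rule nn_integral_mono)
      fix x
      show "ennreal (norm (?G x)) \<le> indicator \<Omega> x * indicator \<Omega> (x + ?c) * ennreal \<bar>w (x + ?c) - w x\<bar>"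
      proof (cases "x + ?c \<in> K")
        case True
        have "x \<in> cball (x + ?c) \<delta>"
          using k h[of k] by (simp add: dist_norm norm_axis_real)
        hence "x \<in> \<Omega>" "x + ?c \<in> \<Omega>" using \<delta>(2) True K(2) by blast+
        moreover have "norm (?G x) \<le> \<bar>w (x + ?c) - w x\<bar>"
          using f(2)[of "x + ?c"] by (simp add: abs_mult abs_minus_commute mult_left_le)
        ultimately show ?thesis by (simp add: ennreal_leI)
      qed (use K(3) in simp)
    qed
    also have "\<dots> \<le> ennreal (C * \<bar>h k\<bar>)"
      using tb unfolding translation_bounded_def by blast
    finally have "norm (\<integral>x. ?G x \<partial>lborel) \<le> C * \<bar>h k\<bar>"
      using \<open>0 \<le> C\<close> by (subst (asm) ennreal_le_iff) auto
    hence "(\<integral>x. ?G x \<partial>lborel) \<le> C * h k" using h[of k] by simp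
    hence "(\<integral>x. ?G x \<partial>lborel) * real (Suc k) \<le> C * h k * real (Suc k)"
      by (rule mult_right_mono) simp
    thus ?thesis unfolding eq by (simp add: h_def)
  qed
  have "h \<longlonglongrightarrow> 0"
    unfolding h_def using LIMSEQ_inverse_real_of_nat by (simp add: inverse_eq_divide)
  hence "eventually (\<lambda>k. h k < \<delta>) sequentially" using \<delta>(1) by (rule order_tendstoD)
  hence "eventually (\<lambda>k. (\<integral>x. D k x \<partial>lborel) \<le> C) sequentially"
    by eventually_elim (rule D_le)
  thus "(\<integral>x. w x * partial i f x \<partial>lborel) \<le> C"
    using tendsto_upperbound[OF conv] by simp
qed

section \<open>Integrals over Borel subsets\<close>

lemma integral_lebesgue_on_borel:
  fixes f :: "'a::euclidean_space \<Rightarrow> real"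
  assumes [measurable]: "\<Omega> \<in> sets borel" "f \<in> borel_measurable borel"
  shows "(\<integral>x. f x \<partial>lebesgue_on \<Omega>) = (\<integral>x. indicator \<Omega> x * f x \<partial>lborel)"
  by (subst integral_restrict_space) (simp_all add: integral_completion)

lemma integrable_lebesgue_on_borel:
  fixes f :: "'a::euclidean_space \<Rightarrow> real"
  assumes [measurable]: "\<Omega> \<in> sets borel" "f \<in> borel_measurable borel"
  shows "integrable (lebesgue_on \<Omega>) f \<longleftrightarrow> integrable lborel (\<lambda>x. indicator \<Omega> x * f x)"
  by (subst integrable_restrict_space) (simp_all add: integrable_completion)

lemma AE_lebesgue_on_borel:
  assumes "\<Omega> \<in> sets borel"
  shows "(AE x in lebesgue_on \<Omega>. P x) \<longleftrightarrow> (AE x in lborel. x \<in> \<Omega> \<longrightarrow> P x)"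
  using assms by (subst AE_restrict_space_iff) (auto simp: AE_completion_iff)

lemma borel_measurable_lebesgue_on: "f \<in> borel_measurable borel \<Longrightarrow> f \<in> borel_measurable (lebesgue_on \<Omega>)"
  by (intro measurable_restrict_space1 measurable_completion) simp

section \<open>Raviart--Thomas fields with a single component\<close>

text \<open>
  The piecewise affine function with nodes \<open>l < m < r\<close>, equal to one at \<open>m\<close> and zero outside \<open>(l, r)\<close>.
\<close>

definition hat :: "real \<Rightarrow> real \<Rightarrow> real \<Rightarrow> real \<Rightarrow> real" where
  "hat l m r t = max 0 (min ((t - l) / (m - l)) ((r - t) / (r - m)))"

lemma hat_measurable [measurable]: "hat l m r \<in> borel_measurable borel"
  unfolding hat_def by measurable

context
  fixes l m r :: real
  assumes lmr: "l < m" "m < r"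
begin

lemma hat_left: "l \<le> t \<Longrightarrow> t \<le> m \<Longrightarrow> hat l m r t = (t - l) / (m - l)"
proof -
  assume t: "l \<le> t" "t \<le> m"
  have "(t - l) / (m - l) \<le> 1" "1 \<le> (r - t) / (r - m)" "0 \<le> (t - l) / (m - l)"
    using t lmr by (auto simp: field_simps)
  thus ?thesis by (simp add: hat_def)
qed

lemma hat_right: "m \<le> t \<Longrightarrow> t \<le> r \<Longrightarrow> hat l m r t = (r - t) / (r - m)"
proof -
  assume t: "m \<le> t" "t \<le> r"
  have "1 \<le> (t - l) / (m - l)" "(r - t) / (r - m) \<le> 1" "0 \<le> (r - t) / (r - m)"
    using t lmr by (auto simp: field_simps)
  thus ?thesis by (simp add: hat_def)
qed

lemma hat_outside: "t \<le> l \<or> r \<le> t \<Longrightarrow> hat l m r t = 0"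
proof -
  assume "t \<le> l \<or> r \<le> t"
  hence "(t - l) / (m - l) \<le> 0 \<or> (r - t) / (r - m) \<le> 0"
    using lmr by (auto simp: divide_le_0_iff)
  thus ?thesis by (auto simp: hat_def)
qed

lemma hat_nonneg: "0 \<le> hat l m r t"
  by (simp add: hat_def)

lemma hat_le_1: "hat l m r t \<le> 1"
proof (cases "t \<le> m")
  case True
  hence "(t - l) / (m - l) \<le> 1" using lmr by (simp add: field_simps)
  thus ?thesis by (simp add: hat_def)
next
  case False
  hence "(r - t) / (r - m) \<le> 1" using lmr by (simp add: field_simps)
  thus ?thesis by (simp add: hat_def)
qed

lemma hat_Lipschitz: "\<bar>hat l m r s - hat l m r t\<bar> \<le> (1 / (m - l) + 1 / (r - m)) * \<bar>s - t\<bar>"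
proof -
  define A where "A = 1 / (m - l)"
  define B where "B = 1 / (r - m)"
  have AB: "0 \<le> A" "0 \<le> B" using lmr by (auto simp: A_def B_def)
  have 1: "\<bar>(s - l) / (m - l) - (t - l) / (m - l)\<bar> = A * \<bar>s - t\<bar>"
    using lmr by (simp add: A_def diff_divide_distrib[symmetric] abs_divide)
  have 2: "\<bar>(r - s) / (r - m) - (r - t) / (r - m)\<bar> = B * \<bar>s - t\<bar>"
    using lmr by (simp add: B_def diff_divide_distrib[symmetric] abs_divide abs_minus_commute)
  have "\<bar>max 0 (min x y) - max 0 (min x' y')\<bar> \<le> max \<bar>x - x'\<bar> \<bar>y - y'\<bar>" for x y x' y' :: real
    by (auto simp: max_def min_def abs_if)
  hence "\<bar>hat l m r s - hat l m r t\<bar> \<le> max (A * \<bar>s - t\<bar>) (B * \<bar>s - t\<bar>)"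
    unfolding hat_def 1[symmetric] 2[symmetric] .
  also have "\<dots> \<le> (A + B) * \<bar>s - t\<bar>"
    using AB by (intro max.boundedI mult_right_mono) auto
  finally show ?thesis unfolding A_def B_def .
qed

definition hat_slope :: "real \<Rightarrow> real" where
  "hat_slope t = (if l < t \<and> t < m then 1 / (m - l) else if m < t \<and> t < r then - 1 / (r - m) else 0)"

lemma hat_has_derivative:
  assumes "t \<noteq> l" "t \<noteq> m" "t \<noteq> r"
  shows "(hat l m r has_real_derivative hat_slope t) (at t)"
proof -
  consider "t < l" | "l < t" "t < m" | "m < t" "t < r" | "r < t" using assms by linarith
  thus ?thesis
  proof cases
    case 1
    have "((\<lambda>t. 0) has_real_derivative hat_slope t) (at t)"
      using 1 lmr by (simp add: hat_slope_def)
    thus ?thesis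
      by (rule has_field_derivative_transform_within_open[of _ _ _ "{..<l}"]) (use 1 in \<open>auto simp: hat_outside\<close>)
  next
    case 2
    have "((\<lambda>t. (t - l) / (m - l)) has_real_derivative hat_slope t) (at t)"
      using 2 lmr by (auto simp: hat_slope_def intro!: derivative_eq_intros)
    thus ?thesis
      by (rule has_field_derivative_transform_within_open[of _ _ _ "{l<..<m}"]) (use 2 in \<open>auto simp: hat_left\<close>)
  next
    case 3
    have "((\<lambda>t. (r - t) * c) has_real_derivative - c) (at t)" for c
      by (auto intro!: derivative_eq_intros)
    from this[of "1 / (r - m)"] have "((\<lambda>t. (r - t) / (r - m)) has_real_derivative hat_slope t) (at t)"
      using 3 by (simp add: hat_slope_def)
    thus ?thesis
      by (rule has_field_derivative_transform_within_open[of _ _ _ "{m<..<r}"]) (use 3 in \<open>auto simp: hat_right\<close>)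
  next
    case 4
    have "((\<lambda>t. 0) has_real_derivative hat_slope t) (at t)"
      using 4 lmr by (simp add: hat_slope_def)
    thus ?thesis
      by (rule has_field_derivative_transform_within_open[of _ _ _ "{r<..}"]) (use 4 in \<open>auto simp: hat_outside\<close>)
  qed
qed

lemma hat_difference_quotient:
  assumes "t \<noteq> l" "t \<noteq> m" "t \<noteq> r"
  shows "(\<lambda>k. (hat l m r (t + 1 / real (Suc k)) - hat l m r t) * real (Suc k)) \<longlonglongrightarrow> hat_slope t"
proof -
  have "((\<lambda>h. (hat l m r (t + h) - hat l m r t) / h) \<longlongrightarrow> hat_slope t) (at 0)"
    using hat_has_derivative[OF assms] unfolding DERIV_def .
  moreover have "filterlim (\<lambda>k. 1 / real (Suc k)) (at 0) sequentially"
    unfolding filterlim_at using LIMSEQ_inverse_real_of_nat by (auto simp: inverse_eq_divide)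
  ultimately have "(\<lambda>k. (hat l m r (t + 1 / real (Suc k)) - hat l m r t) / (1 / real (Suc k))) \<longlonglongrightarrow> hat_slope t"
    by (rule filterlim_compose)
  thus ?thesis by (simp only: divide_divide_eq_right div_by_1)
qed

end

context axis_grid
begin

text \<open>
  An interior facet orthogonal to \<open>e\<^sub>i\<close> is addressed by the index of the cell below it; the cell above
  it has index \<open>next_index i K\<close>. The area is the measure in the remaining coordinates, hence \<open>1\<close> when
  the dimension is one.
\<close>

definition faces :: "'n \<Rightarrow> ('n \<Rightarrow> nat) set" where
  "faces i = {K \<in> indices. Suc (K i) < N i}"

definition next_index :: "'n \<Rightarrow> ('n \<Rightarrow> nat) \<Rightarrow> 'n \<Rightarrow> nat" where
  "next_index i K = K(i := Suc (K i))"

definition face_area :: "'n \<Rightarrow> ('n \<Rightarrow> nat) \<Rightarrow> real" where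
  "face_area i K = (\<Prod>j\<in>UNIV - {i}. p j (Suc (K j)) - p j (K j))"

definition tube :: "'n \<Rightarrow> ('n \<Rightarrow> nat) \<Rightarrow> (real^'n) set" where
  "tube i K = {x. \<forall>j. j \<noteq> i \<longrightarrow> p j (K j) < x $ j \<and> x $ j < p j (Suc (K j))}"

text \<open>
  The \<open>i\<close>-th component of the Raviart--Thomas basis field of a facet: its normal component is one on
  that facet and zero on all others. The discontinuity of the indicator across the lateral sides of
  the tube is tangential and does not contribute to the divergence, which is \<open>face_divergence\<close>.
\<close>

definition face_field :: "'n \<Rightarrow> ('n \<Rightarrow> nat) \<Rightarrow> real^'n \<Rightarrow> real" where
  "face_field i K x = indicator (tube i K) x *
     hat (p i (K i)) (p i (Suc (K i))) (p i (Suc (Suc (K i)))) (x $ i)"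

definition face_divergence :: "'n \<Rightarrow> ('n \<Rightarrow> nat) \<Rightarrow> real^'n \<Rightarrow> real" where
  "face_divergence i K x = indicator (cell K) x / (p i (Suc (K i)) - p i (K i))
     - indicator (cell (next_index i K)) x / (p i (Suc (Suc (K i))) - p i (Suc (K i)))"

lemma finite_faces [simp]: "finite (faces i)"
  by (simp add: faces_def)

lemma faces_indices: "K \<in> faces i \<Longrightarrow> K \<in> indices" "K \<in> faces i \<Longrightarrow> next_index i K \<in> indices"
  by (auto simp: faces_def indices_def next_index_def)

lemma faces_node_less:
  assumes "K \<in> faces i"
  shows "p i (K i) < p i (Suc (K i))" "p i (Suc (K i)) < p i (Suc (Suc (K i)))"
  using assms node_step[of "K i" i] node_step[of "Suc (K i)" i] by (auto simp: faces_def)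

lemma measure_cell_face_area:
  "K \<in> indices \<Longrightarrow> measure lborel (cell K) = (p i (Suc (K i)) - p i (K i)) * face_area i K"
  by (simp add: measure_cell face_area_def prod.remove[of UNIV i])

lemma face_area_next_index: "face_area i (next_index i K) = face_area i K"
  unfolding face_area_def by (rule prod.cong) (auto simp: next_index_def)

lemma face_area_nonneg: "K \<in> indices \<Longrightarrow> 0 \<le> face_area i K"
  unfolding face_area_def using cell_width_pos by (intro prod_nonneg) (auto simp: less_imp_le)

lemma tube_measurable [measurable]: "tube i K \<in> sets borel"
  unfolding tube_def by measurable

lemma face_field_measurable [measurable]: "face_field i K \<in> borel_measurable borel"
  unfolding face_field_def by measurable

lemma face_divergence_measurable [measurable]: "face_divergence i K \<in> borel_measurable borel"
  unfolding face_divergence_def by measurable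

lemma mem_tube_shift: "x + axis i t \<in> tube i K \<longleftrightarrow> x \<in> tube i K"
  by (simp add: tube_def axis_def)

lemma mem_cell_tube: "x \<in> cell K \<longleftrightarrow> x \<in> tube i K \<and> p i (K i) < x $ i \<and> x $ i < p i (Suc (K i))"
  by (auto simp: mem_cell tube_def)

lemma mem_cell_next_tube:
  "x \<in> cell (next_index i K) \<longleftrightarrow> x \<in> tube i K \<and> p i (Suc (K i)) < x $ i \<and> x $ i < p i (Suc (Suc (K i)))"
  by (auto simp: mem_cell tube_def next_index_def)

lemma face_field_nonneg: "K \<in> faces i \<Longrightarrow> 0 \<le> face_field i K x"
  by (simp add: face_field_def hat_nonneg faces_node_less)

lemma face_field_le_1: "K \<in> faces i \<Longrightarrow> face_field i K x \<le> 1"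
  by (simp add: face_field_def indicator_def hat_le_1 faces_node_less)

lemma face_field_support:
  assumes K: "K \<in> faces i" and x: "face_field i K x \<noteq> 0"
  shows "x \<in> box a b"
proof -
  have *: "x \<in> tube i K" "p i (K i) < x $ i" "x $ i < p i (Suc (Suc (K i)))"
    using x hat_outside[OF faces_node_less[OF K], of "x $ i"]
    by (auto simp: face_field_def indicator_def not_le[symmetric] split: if_splits)
  have Ki: "\<And>j. K j < N j" "Suc (K i) < N i"
    using K by (auto simp: faces_def indices_def)
  have "a $ j < x $ j \<and> x $ j < b $ j" for j
  proof (cases "j = i")
    case True
    thus ?thesis using * node_mono[of 0 "K i" i] node_mono[of "Suc (Suc (K i))" "N i" i] Ki
      by (simp add: first_node last_node)
  next
    case False
    hence "p j (K j) < x $ j" "x $ j < p j (Suc (K j))" using * by (auto simp: tube_def)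
    thus ?thesis using node_mono[of 0 "K j" j] node_mono[of "Suc (K j)" "N j" j] Ki(1)[of j]
      by (simp add: first_node last_node)
  qed
  thus ?thesis by (simp add: mem_box_cart)
qed

lemma face_field_difference_quotient:
  assumes K: "K \<in> faces i" and x: "\<And>k. x $ i \<noteq> p i k"
  shows "(\<lambda>k. (face_field i K (x + axis i (1 / real (Suc k))) - face_field i K x) * real (Suc k))
    \<longlonglongrightarrow> face_divergence i K x"
proof -
  let ?h = "hat (p i (K i)) (p i (Suc (K i))) (p i (Suc (Suc (K i))))"
  have "(\<lambda>k. indicator (tube i K) x * ((?h (x $ i + 1 / real (Suc k)) - ?h (x $ i)) * real (Suc k))) \<longlonglongrightarrow>
    indicator (tube i K) x * hat_slope (p i (K i)) (p i (Suc (K i))) (p i (Suc (Suc (K i)))) (x $ i)"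
    by (intro tendsto_mult tendsto_const hat_difference_quotient faces_node_less[OF K] x)
  moreover have "indicator (tube i K) x * hat_slope (p i (K i)) (p i (Suc (K i))) (p i (Suc (Suc (K i)))) (x $ i)
      = face_divergence i K x"
    unfolding face_divergence_def
    by (subst hat_slope_def[OF faces_node_less[OF K]])
       (auto simp: indicator_def mem_cell_tube[of x K i] mem_cell_next_tube)
  moreover have "indicator (tube i K) x * ((?h (x $ i + 1 / real (Suc k)) - ?h (x $ i)) * real (Suc k)) =
     (face_field i K (x + axis i (1 / real (Suc k))) - face_field i K x) * real (Suc k)" for k
    unfolding face_field_def indicator_def mem_tube_shift
    by (simp add: axis_def algebra_simps del: of_nat_Suc)
  ultimately show ?thesis by (simp only:)
qed

lemma face_divergence_bounded:
  obtains B where "\<And>x. \<bar>face_divergence i K x\<bar> \<le> B"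
proof
  fix x
  show "\<bar>face_divergence i K x\<bar> \<le> \<bar>1 / (p i (Suc (K i)) - p i (K i))\<bar>
      + \<bar>1 / (p i (Suc (Suc (K i))) - p i (Suc (K i)))\<bar>"
    unfolding face_divergence_def
    by (rule order_trans[OF abs_triangle_ineq4]) (auto simp: indicator_def)
qed

lemma face_divergence_support:
  assumes "K \<in> faces i" "face_divergence i K x \<noteq> 0"
  shows "x \<in> box a b"
proof -
  have "x \<in> cell K \<or> x \<in> cell (next_index i K)"
    using assms(2) by (rule contrapos_np) (simp add: face_divergence_def)
  thus ?thesis
    using cell_subset[OF faces_indices(1)[OF assms(1)]] cell_subset[OF faces_indices(2)[OF assms(1)]] by blast
qed

lemma box_norm_bound:
  obtains R where "\<And>x. x \<in> box a b \<Longrightarrow> norm x \<le> R"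
  using bounded_box[of a b] by (auto simp: bounded_iff)

lemma face_field_by_parts:
  fixes \<psi> :: "real^'n \<Rightarrow> real"
  assumes K: "K \<in> faces i" and \<psi>: "C1 \<psi>"
  shows "integrable lborel (\<lambda>x. face_field i K x * partial i \<psi> x)"
    and "integrable lborel (\<lambda>x. face_divergence i K x * \<psi> x)"
    and "(\<integral>x. face_field i K x * partial i \<psi> x \<partial>lborel) = - (\<integral>x. face_divergence i K x * \<psi> x \<partial>lborel)"
proof -
  note [measurable] = C1_measurable[OF \<psi>] C1_partial_measurable[OF \<psi>]
  obtain R where R: "\<And>x. x \<in> box a b \<Longrightarrow> norm x \<le> R" using box_norm_bound by blast
  obtain B where B: "\<And>x. \<bar>face_divergence i K x\<bar> \<le> B" using face_divergence_bounded by blast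
  obtain M where M: "0 \<le> M" "\<And>x. norm x \<le> R \<Longrightarrow> \<bar>\<psi> x\<bar> \<le> M" "\<And>x. norm x \<le> R \<Longrightarrow> \<bar>partial i \<psi> x\<bar> \<le> M"
    by (rule C1_bounds[OF \<psi>, of R i]) blast
  have B0: "0 \<le> B" using B[of 0] by linarith
  have field_abs: "\<bar>face_field i K x\<bar> \<le> 1" for x
    using face_field_nonneg[OF K, of x] face_field_le_1[OF K, of x] by simp
  show 1: "integrable lborel (\<lambda>x. face_field i K x * partial i \<psi> x)"
  proof (rule integrable_bounded_support[where R = R and B = "1 * M"])
    show "\<bar>face_field i K x * partial i \<psi> x\<bar> \<le> 1 * M" if "norm x \<le> R" for x
      unfolding abs_mult using field_abs M that by (intro mult_mono) auto
  qed (use face_field_support[OF K] R in auto)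
  show 2: "integrable lborel (\<lambda>x. face_divergence i K x * \<psi> x)"
  proof (rule integrable_bounded_support[where R = R and B = "B * M"])
    show "\<bar>face_divergence i K x * \<psi> x\<bar> \<le> B * M" if "norm x \<le> R" for x
      unfolding abs_mult using B B0 M that by (intro mult_mono) auto
  qed (use face_divergence_support[OF K] R in auto)
  have "(\<integral>x. face_field i K x * partial i \<psi> x + face_divergence i K x * \<psi> x \<partial>lborel) = 0"
  proof (rule integral_by_parts_Lipschitz[where R = R and B = 1, OF _ _ _ field_abs _ _ \<psi>])
    show "norm x \<le> R" if "face_field i K x \<noteq> 0" for x
      using face_field_support[OF K that] R by blast
    show "\<bar>face_field i K (x + axis i t) - face_field i K x\<bar>
        \<le> (1 / (p i (Suc (K i)) - p i (K i)) + 1 / (p i (Suc (Suc (K i))) - p i (Suc (K i)))) * t"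
      if "0 \<le> t" for x t
      using hat_Lipschitz[OF faces_node_less[OF K], of "x $ i + t" "x $ i"] that faces_node_less[OF K]
      unfolding face_field_def indicator_def mem_tube_shift by (auto simp: axis_def)
    show "AE x in lborel. (\<lambda>k. (face_field i K (x + axis i (1 / real (Suc k))) - face_field i K x) * real (Suc k))
        \<longlonglongrightarrow> face_divergence i K x"
      using AE_off_nodes
    proof eventually_elim
      case (elim x)
      thus ?case by (intro face_field_difference_quotient K) auto
    qed
  qed auto
  thus "(\<integral>x. face_field i K x * partial i \<psi> x \<partial>lborel) = - (\<integral>x. face_divergence i K x * \<psi> x \<partial>lborel)"
    using 1 2 by simp
qed

text \<open>
  A basis field lives on the two cells adjacent to its facet only.
\<close>

lemma face_field_nonzero_cell:
  assumes "K \<in> faces i" "M \<in> indices" "x \<in> cell M" "face_field i K x \<noteq> 0"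
  shows "K = M \<or> next_index i K = M"
proof -
  have x: "x \<in> tube i K" "p i (K i) < x $ i" "x $ i < p i (Suc (Suc (K i)))"
    using assms(4) hat_outside[OF faces_node_less[OF assms(1)], of "x $ i"]
    by (auto simp: face_field_def indicator_def not_le[symmetric] split: if_splits)
  have Ki: "\<And>j. K j < N j" "Suc (K i) < N i" "\<And>j. M j < N j"
    using assms by (auto simp: faces_def indices_def)
  have Mx: "p j (M j) < x $ j" "x $ j < p j (Suc (M j))" for j
    using assms(3) by (auto simp: mem_cell)
  have other: "K j = M j" if "j \<noteq> i" for j
    using interval_index_unique[of "K j" j "M j" "x $ j"] Ki Mx[of j] x(1) that by (auto simp: tube_def)
  have "\<not> M i < K i" using node_mono[of "Suc (M i)" "K i" i] Mx[of i] x Ki(1)[of i] by auto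
  moreover have "\<not> Suc (K i) < M i"
    using node_mono[of "Suc (Suc (K i))" "M i" i] Mx[of i] x Ki(3)[of i] by auto
  ultimately have "K i = M i \<or> Suc (K i) = M i" by linarith
  thus ?thesis
  proof
    assume "K i = M i"
    hence "K = M" using other by (intro ext) metis
    thus ?thesis ..
  next
    assume "Suc (K i) = M i"
    hence "next_index i K = M" using other by (intro ext) (auto simp: next_index_def)
    thus ?thesis ..
  qed
qed

lemma face_field_on_cell:
  assumes "K \<in> faces i" "x \<in> cell K"
  shows "face_field i K x = (x $ i - p i (K i)) / (p i (Suc (K i)) - p i (K i))"
  using assms hat_left[OF faces_node_less[OF assms(1)], of "x $ i"]
  by (simp add: face_field_def mem_cell_tube[of x K i])

lemma face_field_on_next_cell:
  assumes "K \<in> faces i" "x \<in> cell (next_index i K)"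
  shows "face_field i K x = (p i (Suc (Suc (K i))) - x $ i) / (p i (Suc (Suc (K i))) - p i (Suc (K i)))"
  using assms hat_right[OF faces_node_less[OF assms(1)], of "x $ i"]
  by (simp add: face_field_def mem_cell_next_tube)

lemma face_field_affine:
  assumes K: "K \<in> faces i" and M: "M \<in> indices"
  shows "\<exists>\<alpha> \<beta>. \<forall>x\<in>cell M. face_field i K x = \<alpha> + \<beta> * x $ i"
proof -
  consider "M = K" | "M = next_index i K" | "M \<noteq> K" "M \<noteq> next_index i K" by blast
  thus ?thesis
  proof cases
    case 1
    let ?d = "p i (Suc (K i)) - p i (K i)"
    show ?thesis
      by (rule exI[of _ "- p i (K i) / ?d"], rule exI[of _ "1 / ?d"])
        (simp add: 1 face_field_on_cell[OF K] diff_divide_distrib)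
  next
    case 2
    let ?d = "p i (Suc (Suc (K i))) - p i (Suc (K i))"
    show ?thesis
      by (rule exI[of _ "p i (Suc (Suc (K i))) / ?d"], rule exI[of _ "- 1 / ?d"])
        (simp add: 2 face_field_on_next_cell[OF K] diff_divide_distrib)
  next
    case 3
    hence "\<forall>x\<in>cell M. face_field i K x = 0"
      using face_field_nonzero_cell[OF K M] by blast
    thus ?thesis by (intro exI[of _ 0]) simp
  qed
qed

text \<open>
  On a cell only the fields of its lower and upper facet are nonzero; they are the two affine
  functions that interpolate between zero and one in opposite directions. In the first and last
  layer one of them is missing, which leaves an inequality.
\<close>

lemma sum_face_field_le_1:
  assumes M: "M \<in> indices" and x: "x \<in> cell M"
  shows "(\<Sum>K\<in>faces i. face_field i K x) \<le> 1"
proof -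
  define d where "d = p i (Suc (M i)) - p i (M i)"
  \<comment> \<open>The relative position of \<open>x\<close> between the lower and the upper facet of its cell.\<close>
  define e where "e = (x $ i - p i (M i)) / d"
  have d: "0 < d" using cell_width_pos[OF M, of i] by (simp add: d_def)
  have e: "0 \<le> e" "e \<le> 1"
    using x d by (auto simp: e_def d_def mem_cell field_simps less_imp_le)
  \<comment> \<open>The cell below \<open>M\<close>. For \<open>M i = 0\<close> truncated subtraction gives \<open>M\<close> itself, hence the guards \<open>M i > 0\<close>.\<close>
  define L where "L = M(i := M i - 1)"
  have nz: "K = M \<or> (K = L \<and> M i > 0)" if "K \<in> faces i" "face_field i K x \<noteq> 0" for K
    using face_field_nonzero_cell[OF that(1) M x that(2)] by (auto simp: L_def next_index_def)
  have field_M: "face_field i M x \<le> e" if "M \<in> faces i"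
    using face_field_on_cell[OF that x] by (simp add: e_def d_def)
  have field_L: "face_field i L x \<le> 1 - e" if "L \<in> faces i" "M i > 0"
  proof -
    have "next_index i L = M" "Suc (L i) = M i" using that(2) by (auto simp: L_def next_index_def)
    hence "face_field i L x = (p i (Suc (M i)) - x $ i) / d"
      using face_field_on_next_cell[OF that(1), of x] x by (simp add: d_def)
    also have "\<dots> = 1 - e" using d by (simp add: e_def d_def field_simps)
    finally show ?thesis by simp
  qed
  have "(\<Sum>K\<in>faces i. face_field i K x) \<le> (\<Sum>K\<in>faces i. (if K = M then e else 0) + (if K = L then if M i > 0 then 1 - e else 0 else 0))"
  proof (rule sum_mono)
    fix K assume K: "K \<in> faces i"
    have "M i > 0 \<Longrightarrow> L \<noteq> M" by (auto simp: L_def fun_eq_iff)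
    thus "face_field i K x \<le> (if K = M then e else 0) + (if K = L then if M i > 0 then 1 - e else 0 else 0)"
      using nz[OF K] field_M field_L K e by (cases "face_field i K x = 0") auto
  qed
  also have "\<dots> = (if M \<in> faces i then e else 0) + (if L \<in> faces i \<and> M i > 0 then 1 - e else 0)"
    by (simp add: sum.distrib sum.delta)
  also have "\<dots> \<le> 1" using e by auto
  finally show ?thesis .
qed

end

section \<open>Jumps are controlled by the discrete total variation\<close>

context axis_grid
begin

text \<open>
  Testing with a basis field sees exactly the jump across its facet: the divergence is the
  reciprocal of the width on either side, with opposite signs.
\<close>

lemma integral_step_function_face_divergence:
  assumes K: "K \<in> faces i"
  shows "integrable lborel (\<lambda>x. step_function c x * face_divergence i K x)"
    and "(\<integral>x. step_function c x * face_divergence i K x \<partial>lborel)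
      = (c K - c (next_index i K)) * face_area i K"
proof -
  define d where "d = p i (Suc (K i)) - p i (K i)"
  define d' where "d' = p i (Suc (Suc (K i))) - p i (Suc (K i))"
  have d: "0 < d" "0 < d'" using faces_node_less[OF K] by (auto simp: d_def d'_def)
  have eq: "step_function c x * face_divergence i K x =
      c K / d * indicator (cell K) x - c (next_index i K) / d' * indicator (cell (next_index i K)) x" for x
    using step_function_cell[OF faces_indices(1)[OF K], of x c] step_function_cell[OF faces_indices(2)[OF K], of x c]
    by (auto simp: face_divergence_def indicator_def d_def d'_def algebra_simps)
  have int: "integrable lborel (indicator (cell L) :: _ \<Rightarrow> real)" for L
    using emeasure_cell_finite by (intro integrable_real_indicator) auto
  show "integrable lborel (\<lambda>x. step_function c x * face_divergence i K x)"
    unfolding eq by (intro Bochner_Integration.integrable_diff integrable_mult_right int)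
  have "measure lborel (cell K) = d * face_area i K"
    using measure_cell_face_area[OF faces_indices(1)[OF K], of i] by (simp add: d_def)
  moreover have "measure lborel (cell (next_index i K)) = d' * face_area i K"
    using measure_cell_face_area[OF faces_indices(2)[OF K], of i]
    by (simp add: d'_def face_area_next_index) (simp add: next_index_def)
  moreover have "(\<integral>x. step_function c x * face_divergence i K x \<partial>lborel) =
      c K / d * measure lborel (cell K) - c (next_index i K) / d' * measure lborel (cell (next_index i K))"
    unfolding eq using int by simp
  ultimately show "(\<integral>x. step_function c x * face_divergence i K x \<partial>lborel)
      = (c K - c (next_index i K)) * face_area i K"
    using d by (simp add: left_diff_distrib)
qed

text \<open>
  The competitor \<open>\<phi>\<close> has normal component \<open>sgn (c K - c (next_index i K))\<close> on the facet of \<open>K\<close> and no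
  other component, so every facet orthogonal to \<open>e\<^sub>i\<close> contributes the absolute value of its jump.
\<close>

lemma sum_jumps_le_TV_grid:
  assumes TV: "TV_grid (box a b) (cell ` indices) w \<le> ereal C"
    and w: "AE x in lebesgue_on (box a b). w x = step_function c x"
    and w_meas: "w \<in> borel_measurable (lebesgue_on (box a b))"
  shows "(\<Sum>K\<in>faces i. \<bar>c (next_index i K) - c K\<bar> * face_area i K) \<le> C"
proof -
  let ?\<Omega> = "box a b"
  define s where "s K = sgn (c K - c (next_index i K))" for K
  define U where "U x = (\<Sum>K\<in>faces i. s K * face_field i K x)" for x
  define G where "G x = (\<Sum>K\<in>faces i. s K * face_divergence i K x)" for x
  define \<phi> where "\<phi> x = (axis i (U x) :: real^'n)" for x
  have [measurable]: "U \<in> borel_measurable borel" "G \<in> borel_measurable borel"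
    unfolding U_def G_def by measurable
  have axis_meas: "(\<lambda>t. axis i t :: real^'n) \<in> borel_measurable borel"
    by (subst axis_eq_scaleR) measurable
  have [measurable]: "\<phi> \<in> borel_measurable borel"
    unfolding \<phi>_def by (rule measurable_compose[OF _ axis_meas]) measurable
  have norm_\<phi>: "norm (\<phi> x) = \<bar>U x\<bar>" for x by (simp add: \<phi>_def norm_axis_real)
  have s: "\<bar>s K\<bar> \<le> 1" for K by (simp add: s_def sgn_if)
  have U_abs: "\<bar>U x\<bar> \<le> (\<Sum>K\<in>faces i. face_field i K x)" for x
    unfolding U_def
    by (intro order_trans[OF sum_abs] sum_mono)
      (use s face_field_nonneg in \<open>auto simp: abs_mult intro!: mult_left_le_one_le\<close>)
  have U_bound: "\<bar>U x\<bar> \<le> card (faces i)" for x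
    using order_trans[OF U_abs sum_bounded_above[of "faces i" "\<lambda>K. face_field i K x" 1]] face_field_le_1 by simp
  have U_cell: "\<bar>U x\<bar> \<le> 1" if "M \<in> indices" "x \<in> cell M" for x M
    using order_trans[OF U_abs sum_face_field_le_1[OF that]] .
  obtain R where R: "\<And>x. x \<in> ?\<Omega> \<Longrightarrow> norm x \<le> R" using box_norm_bound by blast
  have U_support: "x \<in> ?\<Omega>" if "U x \<noteq> 0" for x
  proof (rule ccontr)
    assume "x \<notin> ?\<Omega>"
    hence "face_field i K x = 0" if "K \<in> faces i" for K using face_field_support[OF that] by blast
    thus False using that by (simp add: U_def)
  qed
  have G_support: "x \<in> ?\<Omega>" if "G x \<noteq> 0" for x
  proof (rule ccontr)
    assume "x \<notin> ?\<Omega>"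
    hence "face_divergence i K x = 0" if "K \<in> faces i" for K using face_divergence_support[OF that] by blast
    thus False using that by (simp add: G_def)
  qed
  have "\<forall>K. \<exists>B. \<forall>x. \<bar>face_divergence i K x\<bar> \<le> B" using face_divergence_bounded by metis
  then obtain B where B: "\<And>K x. \<bar>face_divergence i K x\<bar> \<le> B K" by metis
  have G_bound: "\<bar>G x\<bar> \<le> (\<Sum>K\<in>faces i. B K)" for x
    unfolding G_def
    by (intro order_trans[OF sum_abs] sum_mono)
      (use s B in \<open>auto simp: abs_mult intro!: order_trans[OF mult_left_le_one_le]\<close>)
  have int_sq: "integrable (lebesgue_on ?\<Omega>) (\<lambda>x. (f x)\<^sup>2)"
    if [measurable]: "f \<in> borel_measurable borel" and f: "\<And>x. \<bar>f x\<bar> \<le> D" for f :: "real^'n \<Rightarrow> real" and D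
  proof (subst integrable_lebesgue_on_borel)
    show "integrable lborel (\<lambda>x. indicator ?\<Omega> x * (f x)\<^sup>2)"
    proof (rule integrable_bounded_support[where R = R and B = "D\<^sup>2"])
      show "\<bar>indicator ?\<Omega> x * (f x)\<^sup>2\<bar> \<le> D\<^sup>2" for x
        using power_mono[OF f[of x], of 2] by (simp add: indicator_def)
    qed (use R in \<open>auto simp: indicator_def split: if_splits\<close>)
  qed auto
  have L2_\<phi>: "L2_on ?\<Omega> \<phi>"
    unfolding L2_on_def norm_\<phi> using int_sq[of "\<lambda>x. \<bar>U x\<bar>" "card (faces i)"] U_bound
    by (auto intro!: borel_measurable_lebesgue_on)
  have L2_G: "L2_on ?\<Omega> G"
    unfolding L2_on_def using int_sq[of G] G_bound by (auto intro!: borel_measurable_lebesgue_on)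
  have inner_\<phi>: "\<phi> x \<bullet> gradient \<psi> x = U x * partial i \<psi> x" for \<psi> x
    by (simp add: \<phi>_def gradient_def inner_axis' )
  have parts: "(\<integral>x. \<phi> x \<bullet> gradient \<psi> x \<partial>lebesgue_on ?\<Omega>) = - (\<integral>x. G x * \<psi> x \<partial>lebesgue_on ?\<Omega>)"
    if \<psi>: "C1 \<psi>" for \<psi>
  proof -
    note [measurable] = C1_measurable[OF \<psi>] C1_partial_measurable[OF \<psi>]
    have "(\<integral>x. \<phi> x \<bullet> gradient \<psi> x \<partial>lebesgue_on ?\<Omega>) = (\<integral>x. indicator ?\<Omega> x * (U x * partial i \<psi> x) \<partial>lborel)"
      unfolding inner_\<phi> by (rule integral_lebesgue_on_borel) auto
    also have "\<dots> = (\<integral>x. U x * partial i \<psi> x \<partial>lborel)"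
      by (rule Bochner_Integration.integral_cong) (use U_support in \<open>auto simp: indicator_def\<close>)
    also have "\<dots> = (\<integral>x. (\<Sum>K\<in>faces i. s K * (face_field i K x * partial i \<psi> x)) \<partial>lborel)"
      by (simp add: U_def sum_distrib_right mult.assoc)
    also have "\<dots> = (\<Sum>K\<in>faces i. s K * (\<integral>x. face_field i K x * partial i \<psi> x \<partial>lborel))"
      by (subst Bochner_Integration.integral_sum) (auto intro!: face_field_by_parts \<psi>)
    also have "\<dots> = - (\<Sum>K\<in>faces i. s K * (\<integral>x. face_divergence i K x * \<psi> x \<partial>lborel))"
      by (simp add: face_field_by_parts(3)[OF _ \<psi>] sum_negf)
    also have "(\<Sum>K\<in>faces i. s K * (\<integral>x. face_divergence i K x * \<psi> x \<partial>lborel)) =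
        (\<integral>x. (\<Sum>K\<in>faces i. s K * (face_divergence i K x * \<psi> x)) \<partial>lborel)"
      by (subst Bochner_Integration.integral_sum) (auto intro!: face_field_by_parts \<psi>)
    also have "\<dots> = (\<integral>x. G x * \<psi> x \<partial>lborel)"
      by (simp add: G_def sum_distrib_right mult.assoc)
    also have "\<dots> = (\<integral>x. indicator ?\<Omega> x * (G x * \<psi> x) \<partial>lborel)"
      by (rule Bochner_Integration.integral_cong) (use G_support in \<open>auto simp: indicator_def\<close>)
    also have "\<dots> = (\<integral>x. G x * \<psi> x \<partial>lebesgue_on ?\<Omega>)"
      by (rule integral_lebesgue_on_borel[symmetric]) auto
    finally show ?thesis .
  qed
  have weak: "has_weak_divergence ?\<Omega> \<phi> G"
    unfolding has_weak_divergence_def using parts by (auto simp: C1_compact_def)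
  have affine: "\<exists>\<alpha> \<beta> :: real^'n. AE x in lebesgue_on Q. \<forall>j. \<phi> x $ j = \<alpha> $ j + \<beta> $ j * x $ j"
    if Q: "Q \<in> cell ` indices" for Q
  proof -
    obtain M where M: "M \<in> indices" "Q = cell M" using Q by blast
    have "\<forall>K\<in>faces i. \<exists>\<alpha> \<beta>. \<forall>x\<in>cell M. face_field i K x = \<alpha> + \<beta> * x $ i"
      using face_field_affine M by blast
    then obtain \<alpha> \<beta> where \<alpha>\<beta>: "\<And>K x. K \<in> faces i \<Longrightarrow> x \<in> cell M \<Longrightarrow> face_field i K x = \<alpha> K + \<beta> K * x $ i"
      by metis
    have "\<phi> x $ j = (axis i (\<Sum>K\<in>faces i. s K * \<alpha> K) :: real^'n) $ j
        + (axis i (\<Sum>K\<in>faces i. s K * \<beta> K) :: real^'n) $ j * x $ j" if "x \<in> cell M" for x j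
    proof (cases "j = i")
      case True
      have "U x = (\<Sum>K\<in>faces i. s K * (\<alpha> K + \<beta> K * x $ i))"
        unfolding U_def by (rule sum.cong) (use \<alpha>\<beta> that in auto)
      thus ?thesis using True
        by (simp add: \<phi>_def distrib_left sum.distrib sum_distrib_right mult.assoc)
    qed (simp add: \<phi>_def axis_def)
    thus ?thesis
      unfolding M(2) by (intro exI AE_I2) auto
  qed
  have RT: "\<phi> \<in> RT0_0 ?\<Omega> (cell ` indices)"
    unfolding RT0_0_def using L2_\<phi> L2_G weak affine parts by (auto simp: normal_trace_def)
  have unit: "AE x in lebesgue_on ?\<Omega>. norm (\<phi> x) \<le> 1"
    unfolding AE_lebesgue_on_borel[OF borel_open[OF open_box]] norm_\<phi>
    using AE_cell_exists by eventually_elim (use U_cell in blast)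
  have "ereal (\<integral>x. w x * G x \<partial>lebesgue_on ?\<Omega>) \<le> TV_grid ?\<Omega> (cell ` indices) w"
    unfolding TV_grid_def using RT L2_G weak unit by (intro SUP_upper2[of "(\<phi>, G)"]) auto
  hence le: "(\<integral>x. w x * G x \<partial>lebesgue_on ?\<Omega>) \<le> C"
    using order_trans[OF _ TV] by fastforce
  have "(\<integral>x. w x * G x \<partial>lebesgue_on ?\<Omega>) = (\<integral>x. step_function c x * G x \<partial>lebesgue_on ?\<Omega>)"
  proof (rule integral_cong_AE)
    show "(\<lambda>x. w x * G x) \<in> borel_measurable (lebesgue_on ?\<Omega>)"
      by (intro borel_measurable_times w_meas borel_measurable_lebesgue_on) measurable
    show "(\<lambda>x. step_function c x * G x) \<in> borel_measurable (lebesgue_on ?\<Omega>)"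
      by (intro borel_measurable_lebesgue_on) measurable
  qed (use w in auto)
  also have "\<dots> = (\<integral>x. indicator ?\<Omega> x * (step_function c x * G x) \<partial>lborel)"
    by (rule integral_lebesgue_on_borel) auto
  also have "\<dots> = (\<integral>x. step_function c x * G x \<partial>lborel)"
    by (rule Bochner_Integration.integral_cong) (use G_support in \<open>auto simp: indicator_def\<close>)
  also have "\<dots> = (\<integral>x. (\<Sum>K\<in>faces i. s K * (step_function c x * face_divergence i K x)) \<partial>lborel)"
    by (simp add: G_def sum_distrib_left mult.left_commute)
  also have "\<dots> = (\<Sum>K\<in>faces i. s K * (\<integral>x. step_function c x * face_divergence i K x \<partial>lborel))"
    by (subst Bochner_Integration.integral_sum) (auto intro!: integral_step_function_face_divergence)
  also have "\<dots> = (\<Sum>K\<in>faces i. \<bar>c (next_index i K) - c K\<bar> * face_area i K)"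
  proof (rule sum.cong)
    fix K assume K: "K \<in> faces i"
    have "s K * (c K - c (next_index i K)) = \<bar>c (next_index i K) - c K\<bar>"
      by (simp add: s_def abs_sgn_eq sgn_if)
    thus "s K * (\<integral>x. step_function c x * face_divergence i K x \<partial>lborel) = \<bar>c (next_index i K) - c K\<bar> * face_area i K"
      unfolding integral_step_function_face_divergence(2)[OF K] by (simp only: mult.assoc[symmetric])
  qed simp
  finally show ?thesis using le by simp
qed

end

section \<open>Translation estimates\<close>

context axis_grid
begin

text \<open>
  For \<open>t > 0\<close>, the box \<open>S K\<close> below consists of the points whose segment of length \<open>t\<close> in direction \<open>i\<close>
  crosses the facet of \<open>K\<close>; its measure is \<open>t\<close> times the area of the facet. Negative \<open>t\<close> reduces to
  positive \<open>t\<close> by translating the integration variable.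
\<close>

lemma step_function_translation_bounded:
  assumes jumps: "\<And>i. (\<Sum>K\<in>faces i. \<bar>c (next_index i K) - c K\<bar> * face_area i K) \<le> C"
  shows "translation_bounded (box a b) C (step_function c)"
proof -
  let ?\<Omega> = "box a b" and ?w = "step_function c"
  let ?T = "\<lambda>i t x. indicator ?\<Omega> x * indicator ?\<Omega> (x + axis i t) * ennreal \<bar>?w (x + axis i t) - ?w x\<bar>"
  have C0: "0 \<le> C"
    by (rule order_trans[OF _ jumps]) (auto intro!: sum_nonneg mult_nonneg_nonneg face_area_nonneg faces_indices)
  have pos: "(\<integral>\<^sup>+x. ?T i t x \<partial>lborel) \<le> ennreal (C * t)" if t: "0 < t" for i t
  proof -
    define S where "S K = box (\<chi> j. if j = i then p i (Suc (K i)) - t else p j (K j))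
       (\<chi> j. if j = i then p i (Suc (K i)) else p j (Suc (K j)))" for K
    define J where "J K = \<bar>c (next_index i K) - c K\<bar>" for K
    have emeasure_S: "emeasure lborel (S K) = ennreal (t * face_area i K)" if K: "K \<in> faces i" for K
    proof -
      have "emeasure lborel (S K) = ennreal (\<Prod>j\<in>UNIV. (\<chi> j. if j = i then p i (Suc (K i)) else p j (Suc (K j))) $ j
          - (\<chi> j. if j = i then p i (Suc (K i)) - t else p j (K j)) $ j)"
        unfolding S_def
        by (rule emeasure_lborel_box_vec) (use t cell_width_pos[OF faces_indices(1)[OF K]] in \<open>auto simp: less_imp_le\<close>)
      also have "(\<Prod>j\<in>UNIV. (\<chi> j. if j = i then p i (Suc (K i)) else p j (Suc (K j))) $ j
          - (\<chi> j. if j = i then p i (Suc (K i)) - t else p j (K j)) $ j) = t * face_area i K"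
        by (simp add: prod.remove[of UNIV i] face_area_def)
      finally show ?thesis .
    qed
    have pointwise: "AE x in lborel. ?T i t x \<le> ennreal (\<Sum>K\<in>faces i. J K * indicator (S K) x)"
    proof -
      have "AE x in lborel. \<forall>k. (x :: real^'n) $ i \<noteq> p i k - t"
        by (simp add: AE_all_countable AE_coord_neq)
      with AE_off_nodes show ?thesis
      proof eventually_elim
        case (elim x)
        show ?case
        proof (cases "x \<in> ?\<Omega> \<and> x + axis i t \<in> ?\<Omega>")
          case True
          obtain M where M: "M \<in> indices" "x \<in> cell M"
            using cell_exists[of x] True elim by auto
          have "(x + axis i t) $ j \<noteq> p j k" for j k
            using elim(1) spec[OF elim(2), of k] by (auto simp: axis_def algebra_simps)
          then obtain M' where M': "M' \<in> indices" "x + axis i t \<in> cell M'"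
            using cell_exists[of "x + axis i t"] True by auto
          have Mx: "p j (M j) < x $ j" "x $ j < p j (Suc (M j))" "M j < N j" for j
            using M by (auto simp: mem_cell indices_def)
          have M'x: "p j (M' j) < x $ j + axis i t $ j" "x $ j + axis i t $ j < p j (Suc (M' j))" "M' j < N j" for j
            using M' by (auto simp: mem_cell indices_def)
          have "M' j = M j" if "j \<noteq> i" for j
            using interval_index_unique[of "M' j" j "M j" "x $ j"] Mx[of j] M'x[of j] that by (auto simp: axis_def)
          hence M'_eq: "M' = M(i := M' i)" by (auto simp: fun_eq_iff)
          have le: "M i \<le> M' i"
          proof (rule ccontr)
            assume "\<not> M i \<le> M' i"
            hence "p i (Suc (M' i)) \<le> p i (M i)" using Mx(3)[of i] by (intro node_mono) auto
            thus False using Mx(1)[of i] M'x(2)[of i] t by (simp add: axis_def)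
          qed
          \<comment> \<open>The values of the step function along the line of cells from \<open>M\<close> to \<open>M'\<close>; the difference telescopes.\<close>
          define f where "f k = c (M(i := k))" for k
          define I where "I = {M i..<M' i}"
          have face: "M(i := k) \<in> faces i" if "k \<in> I" for k
            using that Mx(3) M'x(3)[of i] by (auto simp: I_def faces_def indices_def)
          have in_S: "x \<in> S (M(i := k))" if "k \<in> I" for k
          proof -
            have "p i (Suc (M i)) \<le> p i (Suc k)" "p i (Suc k) \<le> p i (M' i)"
              using that M'x(3)[of i] by (auto simp: I_def intro!: node_mono)
            hence "x $ i < p i (Suc k)" "p i (Suc k) - t < x $ i"
              using Mx(2)[of i] M'x(1)[of i] by (auto simp: axis_def)
            thus ?thesis using Mx by (auto simp: S_def mem_box_cart)
          qed
          have "?w (x + axis i t) - ?w x = f (M' i) - f (M i)"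
            using step_function_cell[OF M] step_function_cell[OF M'] M'_eq by (simp add: f_def)
          also have "\<dots> = (\<Sum>k\<in>I. f (Suc k) - f k)"
            unfolding I_def using le by (simp add: sum_Suc_diff')
          finally have "\<bar>?w (x + axis i t) - ?w x\<bar> \<le> (\<Sum>k\<in>I. \<bar>f (Suc k) - f k\<bar>)"
            by (simp only: sum_abs)
          also have "\<dots> = (\<Sum>k\<in>I. J (M(i := k)) * indicator (S (M(i := k))) x)"
            using in_S by (intro sum.cong) (auto simp: J_def f_def next_index_def)
          also have "\<dots> = (\<Sum>K\<in>(\<lambda>k. M(i := k)) ` I. J K * indicator (S K) x)"
            by (subst sum.reindex) (auto simp: inj_on_def fun_upd_eqD)
          also have "\<dots> \<le> (\<Sum>K\<in>faces i. J K * indicator (S K) x)"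
            using face by (intro sum_mono2) (auto simp: J_def)
          finally have "ennreal \<bar>?w (x + axis i t) - ?w x\<bar> \<le> ennreal (\<Sum>K\<in>faces i. J K * indicator (S K) x)"
            by (rule ennreal_leI)
          thus ?thesis using True by simp
        qed auto
      qed
    qed
    have [measurable]: "S K \<in> sets borel" for K by (simp add: S_def)
    have "(\<integral>\<^sup>+x. ?T i t x \<partial>lborel) \<le> (\<integral>\<^sup>+x. ennreal (\<Sum>K\<in>faces i. J K * indicator (S K) x) \<partial>lborel)"
      by (rule nn_integral_mono_AE[OF pointwise])
    also have "\<dots> = (\<integral>\<^sup>+x. (\<Sum>K\<in>faces i. ennreal (J K) * indicator (S K) x) \<partial>lborel)"
      by (intro nn_integral_cong, subst sum_ennreal[symmetric])
        (auto simp: J_def ennreal_mult ennreal_indicator)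
    also have "\<dots> = (\<Sum>K\<in>faces i. ennreal (J K) * emeasure lborel (S K))"
      by (subst nn_integral_sum) (auto simp: nn_integral_cmult)
    also have "\<dots> = (\<Sum>K\<in>faces i. ennreal (J K * (t * face_area i K)))"
      by (intro sum.cong) (simp_all add: emeasure_S J_def ennreal_mult')
    also have "\<dots> = ennreal (\<Sum>K\<in>faces i. J K * (t * face_area i K))"
      using t by (intro sum_ennreal) (auto simp: J_def intro!: mult_nonneg_nonneg face_area_nonneg faces_indices)
    also have "(\<Sum>K\<in>faces i. J K * (t * face_area i K)) = t * (\<Sum>K\<in>faces i. J K * face_area i K)"
      by (simp add: sum_distrib_left mult.left_commute)
    also have "ennreal \<dots> \<le> ennreal (C * t)"
      using jumps[of i] t by (intro ennreal_leI) (simp add: J_def mult.commute mult_right_mono)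
    finally show ?thesis .
  qed
  show ?thesis
    unfolding translation_bounded_def
  proof (intro allI)
    fix i and t :: real
    consider "t = 0" | "0 < t" | "t < 0" by linarith
    thus "(\<integral>\<^sup>+x. ?T i t x \<partial>lborel) \<le> ennreal (C * \<bar>t\<bar>)"
    proof cases
      case 1 thus ?thesis by (simp add: axis_zero)
    next
      case 2 thus ?thesis using pos[of t i] by simp
    next
      case 3
      have shift: "x + axis i (- t) + axis i t = x" for x :: "real^'n"
        by (simp add: vec_eq_iff axis_def)
      have "(\<integral>\<^sup>+x. ?T i t x \<partial>lborel) = (\<integral>\<^sup>+x. ?T i t (x + axis i (- t)) \<partial>lborel)"
        by (rule nn_integral_lborel_translate[symmetric]) measurable
      also have "\<dots> = (\<integral>\<^sup>+x. ?T i (- t) x \<partial>lborel)"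
        by (intro nn_integral_cong) (simp add: shift abs_minus_commute mult.commute)
      also have "\<dots> \<le> ennreal (C * (- t))" using 3 by (intro pos) simp
      finally show ?thesis using 3 by simp
    qed
  qed
qed

end

text \<open>
  The shift by \<open>z\<close> is performed one coordinate at a time. All intermediate points stay in the box,
  because each of their coordinates is one of \<open>x\<close> or of \<open>x + z\<close>.
\<close>

lemma translation_bounded_vector:
  fixes z :: "real^'n"
  assumes tb: "translation_bounded (box a b) C w" and [measurable]: "w \<in> borel_measurable borel" and "0 \<le> C"
  shows "(\<integral>\<^sup>+x. indicator (box a b) x * indicator (box a b) (x + z) * ennreal \<bar>w (x + z) - w x\<bar> \<partial>lborel)
     \<le> ennreal (C * (\<Sum>i\<in>UNIV. \<bar>z $ i\<bar>))"
proof -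
  let ?\<Omega> = "box a b"
  define r where "r S = (\<chi> i. if i \<in> S then z $ i else 0)" for S :: "'n set"
  have "(\<integral>\<^sup>+x. indicator ?\<Omega> x * indicator ?\<Omega> (x + z) * ennreal \<bar>w (x + r S) - w x\<bar> \<partial>lborel)
     \<le> ennreal (C * (\<Sum>i\<in>S. \<bar>z $ i\<bar>))" for S :: "'n set"
    using finite[of S]
  proof (induction S rule: finite_induct)
    case empty
    have "r {} = 0" by (simp add: r_def vec_eq_iff)
    thus ?case by simp
  next
    case (insert i S)
    let ?F = "\<lambda>x. indicator ?\<Omega> x * indicator ?\<Omega> (x + axis i (z $ i)) * ennreal \<bar>w (x + axis i (z $ i)) - w x\<bar>"
    let ?G = "\<lambda>x. indicator ?\<Omega> x * indicator ?\<Omega> (x + z) * ennreal \<bar>w (x + r S) - w x\<bar>"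
    have r: "r (insert i S) = r S + axis i (z $ i)"
      using insert.hyps by (auto simp: r_def vec_eq_iff axis_def)
    have "indicator ?\<Omega> x * indicator ?\<Omega> (x + z) * ennreal \<bar>w (x + r (insert i S)) - w x\<bar> \<le> ?F (x + r S) + ?G x" for x
    proof (cases "x \<in> ?\<Omega> \<and> x + z \<in> ?\<Omega>")
      case True
      have "x + r T \<in> ?\<Omega>" for T
        unfolding mem_box_cart
      proof
        fix j
        show "a $ j < (x + r T) $ j \<and> (x + r T) $ j < b $ j"
          using True by (cases "j \<in> T") (auto simp: mem_box_cart r_def)
      qed
      from this[of S] this[of "insert i S"]
      have "x + r S \<in> ?\<Omega>" "x + r S + axis i (z $ i) \<in> ?\<Omega>" by (simp_all add: r add.assoc)
      moreover have "ennreal \<bar>w (x + r (insert i S)) - w x\<bar> \<le>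
          ennreal \<bar>w (x + r S + axis i (z $ i)) - w (x + r S)\<bar> + ennreal \<bar>w (x + r S) - w x\<bar>"
        unfolding r add.assoc by (simp only: ennreal_plus[symmetric] abs_ge_zero) (rule ennreal_leI, linarith)
      ultimately show ?thesis using True by simp
    qed auto
    hence "(\<integral>\<^sup>+x. indicator ?\<Omega> x * indicator ?\<Omega> (x + z) * ennreal \<bar>w (x + r (insert i S)) - w x\<bar> \<partial>lborel)
        \<le> (\<integral>\<^sup>+x. ?F (x + r S) + ?G x \<partial>lborel)"
      by (rule nn_integral_mono)
    also have "\<dots> = (\<integral>\<^sup>+x. ?F (x + r S) \<partial>lborel) + (\<integral>\<^sup>+x. ?G x \<partial>lborel)"
      by (rule nn_integral_add) measurable
    also have "(\<integral>\<^sup>+x. ?F (x + r S) \<partial>lborel) = (\<integral>\<^sup>+x. ?F x \<partial>lborel)"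
      by (rule nn_integral_lborel_translate) measurable
    also have "(\<integral>\<^sup>+x. ?F x \<partial>lborel) + (\<integral>\<^sup>+x. ?G x \<partial>lborel) \<le> ennreal (C * \<bar>z $ i\<bar>) + ennreal (C * (\<Sum>i\<in>S. \<bar>z $ i\<bar>))"
      using tb by (intro add_mono insert.IH) (auto simp: translation_bounded_def)
    also have "\<dots> = ennreal (C * (\<Sum>i\<in>insert i S. \<bar>z $ i\<bar>))"
      using insert.hyps \<open>0 \<le> C\<close>
      by (subst ennreal_plus[symmetric]) (auto simp: distrib_left intro!: mult_nonneg_nonneg sum_nonneg)
    finally show ?case .
  qed
  from this[of UNIV] show ?thesis by (simp add: r_def)
qed

section \<open>Averages over uniform grids\<close>

context axis_grid
begin

text \<open>
  The deviation of \<open>w x\<close> from the average over the cell of \<open>x\<close> is at most the average of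
  \<open>\<bar>w (x + z) - w x\<bar>\<close> over those \<open>z\<close> for which \<open>x + z\<close> lies in the same cell, and such \<open>z\<close> lie in the box
  \<open>H\<close> with half-widths \<open>h i\<close>. Enlarging the range of \<open>z\<close> to \<open>H\<close> decouples it from the cell, so that
  Tonelli's theorem and the estimate for each fixed \<open>z\<close> apply. The factor \<open>2 ^ CARD('n)\<close> is the ratio
  of the measure of \<open>H\<close> to that of a cell.
\<close>

lemma uniform_average_error:
  assumes width: "\<And>K i. K \<in> indices \<Longrightarrow> p i (Suc (K i)) - p i (K i) = h i" and h: "\<And>i. 0 < h i"
    and tb: "translation_bounded (box a b) C w" and w: "integrable lborel w" and C: "0 \<le> C"
  shows "(\<integral>\<^sup>+x. indicator (box a b) x *
      ennreal \<bar>w x - step_function (\<lambda>K. (\<integral>y. indicator (cell K) y * w y \<partial>lborel) / (\<Prod>i\<in>UNIV. h i)) x\<bar> \<partial>lborel)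
    \<le> ennreal (2 ^ CARD('n) * C * (\<Sum>i\<in>UNIV. h i))"
proof -
  let ?\<Omega> = "box a b"
  have [measurable]: "w \<in> borel_measurable borel" using w by auto
  define \<mu> where "\<mu> = (\<Prod>i\<in>UNIV. h i)"
  have \<mu>: "0 < \<mu>" unfolding \<mu>_def using h by (intro prod_pos) auto
  define A where "A = step_function (\<lambda>K. (\<integral>y. indicator (cell K) y * w y \<partial>lborel) / \<mu>)"
  define H where "H = box (\<chi> i. - h i) (\<chi> i. h i)"
  have [measurable]: "H \<in> sets borel" by (simp add: H_def)
  define T where "T x z = indicator ?\<Omega> x * indicator ?\<Omega> (x + z) * ennreal \<bar>w (x + z) - w x\<bar>" for x z
  have [measurable]: "(\<lambda>x. T (fst x) (snd x)) \<in> borel_measurable (borel \<Otimes>\<^sub>M borel)"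
    unfolding T_def by measurable
  have measure_K: "measure lborel (cell K) = \<mu>" if "K \<in> indices" for K
    using width[OF that] by (simp add: measure_cell[OF that] \<mu>_def)
  have pointwise: "AE x in lborel. indicator ?\<Omega> x * ennreal \<bar>w x - A x\<bar> \<le> ennreal (1 / \<mu>) * (\<integral>\<^sup>+z. indicator H z * T x z \<partial>lborel)"
    using AE_cell_exists
  proof eventually_elim
    case (elim x)
    show ?case
    proof (cases "x \<in> ?\<Omega>")
      case True
      then obtain M where M: "M \<in> indices" "x \<in> cell M" using elim by blast
      have int_ind: "integrable lborel (\<lambda>y. indicator (cell M) y :: real)"
        using emeasure_cell_finite by (intro integrable_real_indicator) auto
      have int_w: "integrable lborel (\<lambda>y. indicator (cell M) y * w y)"
        using integrable_mult_indicator[OF _ w, of "cell M"] by simp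
      have "A x = (\<integral>y. indicator (cell M) y * w y \<partial>lborel) / \<mu>"
        unfolding A_def by (rule step_function_cell[OF M])
      moreover have "w x = (\<integral>y. indicator (cell M) y * w x \<partial>lborel) / \<mu>"
        using measure_K[OF M(1)] \<mu> by simp
      ultimately have "w x - A x = (\<integral>y. indicator (cell M) y * w x - indicator (cell M) y * w y \<partial>lborel) / \<mu>"
        using int_ind int_w by (simp add: diff_divide_distrib)
      hence eq: "w x - A x = (\<integral>y. indicator (cell M) y * (w x - w y) \<partial>lborel) / \<mu>"
        by (simp only: right_diff_distrib)
      have int: "integrable lborel (\<lambda>y. indicator (cell M) y * (w x - w y))"
        using int_ind int_w by (simp add: right_diff_distrib)
      have "ennreal \<bar>w x - A x\<bar> = ennreal (1 / \<mu>) * ennreal (norm (\<integral>y. indicator (cell M) y * (w x - w y) \<partial>lborel))"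
        unfolding eq using \<mu> by (simp add: abs_divide ennreal_mult[symmetric])
      also have "\<dots> \<le> ennreal (1 / \<mu>) * (\<integral>\<^sup>+y. ennreal (norm (indicator (cell M) y * (w x - w y))) \<partial>lborel)"
        by (intro mult_left_mono integral_norm_bound_ennreal[OF int]) simp
      also have "(\<integral>\<^sup>+y. ennreal (norm (indicator (cell M) y * (w x - w y))) \<partial>lborel)
          = (\<integral>\<^sup>+z. ennreal (norm (indicator (cell M) (z + x) * (w x - w (z + x)))) \<partial>lborel)"
        by (rule nn_integral_lborel_translate[symmetric]) measurable
      also have "\<dots> \<le> (\<integral>\<^sup>+z. indicator H z * T x z \<partial>lborel)"
      proof (rule nn_integral_mono)
        fix z
        show "ennreal (norm (indicator (cell M) (z + x) * (w x - w (z + x)))) \<le> indicator H z * T x z"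
        proof (cases "z + x \<in> cell M")
          case True': True
          have "- h i < z $ i \<and> z $ i < h i" for i
          proof -
            have "p i (M i) < x $ i" "x $ i < p i (Suc (M i))" "p i (M i) < z $ i + x $ i" "z $ i + x $ i < p i (Suc (M i))"
              using M True' by (auto simp: mem_cell)
            thus ?thesis using width[OF M(1), of i] by linarith
          qed
          hence "z \<in> H" by (simp add: H_def mem_box_cart)
          moreover have "x + z \<in> ?\<Omega>" using cell_subset[OF M(1)] True' by (auto simp: add.commute)
          ultimately show ?thesis using True True' by (simp add: T_def add.commute abs_minus_commute)
        qed simp
      qed
      finally show ?thesis using True by (simp add: mult_left_mono)
    qed simp
  qed
  have "(\<integral>\<^sup>+x. indicator ?\<Omega> x * ennreal \<bar>w x - A x\<bar> \<partial>lborel)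
      \<le> (\<integral>\<^sup>+x. ennreal (1 / \<mu>) * (\<integral>\<^sup>+z. indicator H z * T x z \<partial>lborel) \<partial>lborel)"
    by (rule nn_integral_mono_AE[OF pointwise])
  also have "\<dots> = ennreal (1 / \<mu>) * (\<integral>\<^sup>+x. (\<integral>\<^sup>+z. indicator H z * T x z \<partial>lborel) \<partial>lborel)"
    by (intro nn_integral_cmult) measurable
  also have "(\<integral>\<^sup>+x. (\<integral>\<^sup>+z. indicator H z * T x z \<partial>lborel) \<partial>lborel)
      = (\<integral>\<^sup>+z. (\<integral>\<^sup>+x. indicator H z * T x z \<partial>lborel) \<partial>lborel)"
    by (intro lborel_pair.Fubini'[symmetric]) measurable
  also have "\<dots> \<le> (\<integral>\<^sup>+z. ennreal (C * (\<Sum>i\<in>UNIV. h i)) * indicator H z \<partial>lborel)"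
  proof (rule nn_integral_mono)
    fix z :: "real^'n"
    show "(\<integral>\<^sup>+x. indicator H z * T x z \<partial>lborel) \<le> ennreal (C * (\<Sum>i\<in>UNIV. h i)) * indicator H z"
    proof (cases "z \<in> H")
      case True
      have "(\<integral>\<^sup>+x. T x z \<partial>lborel) \<le> ennreal (C * (\<Sum>i\<in>UNIV. \<bar>z $ i\<bar>))"
        unfolding T_def by (rule translation_bounded_vector[OF tb _ C]) measurable
      also have "\<dots> \<le> ennreal (C * (\<Sum>i\<in>UNIV. h i))"
        using True C by (intro ennreal_leI mult_left_mono sum_mono) (auto simp: H_def mem_box_cart abs_le_iff less_imp_le minus_le_iff)
      finally show ?thesis using True by simp
    qed simp
  qed
  also have "\<dots> = ennreal (C * (\<Sum>i\<in>UNIV. h i)) * emeasure lborel H"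
    by (rule nn_integral_cmult_indicator) simp
  also have "emeasure lborel H = ennreal (2 ^ CARD('n) * \<mu>)"
  proof -
    have "emeasure lborel H = ennreal (\<Prod>i\<in>UNIV. 2 * h i)"
      unfolding H_def using h by (subst emeasure_lborel_box_vec) (auto simp: less_imp_le)
    thus ?thesis by (simp add: prod.distrib \<mu>_def)
  qed
  also have "ennreal (1 / \<mu>) * (ennreal (C * (\<Sum>i\<in>UNIV. h i)) * ennreal (2 ^ CARD('n) * \<mu>))
      = ennreal (2 ^ CARD('n) * C * (\<Sum>i\<in>UNIV. h i))"
    using \<mu> C h by (simp add: ennreal_mult[symmetric] sum_nonneg less_imp_le field_simps)
  finally show ?thesis unfolding A_def \<mu>_def by (simp add: mult_left_mono)
qed

end

section \<open>Compactness in the space of integrable functions\<close>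

text \<open>
  Completeness of \<open>L\<^sup>1\<close>: some subsequence converges almost everywhere, and Fatou's lemma carries the
  Cauchy estimate over to its limit.
\<close>

lemma L1_Cauchy_convergent:
  fixes s :: "nat \<Rightarrow> 'a \<Rightarrow> real"
  assumes s: "\<And>n. integrable M (s n)"
    and Cauchy: "\<And>e. e > 0 \<Longrightarrow> \<exists>n0. \<forall>j\<ge>n0. \<forall>k\<ge>n0. (\<integral>x. \<bar>s j x - s k x\<bar> \<partial>M) < e"
  obtains v where "integrable M v" "(\<lambda>n. \<integral>x. \<bar>s n x - v x\<bar> \<partial>M) \<longlonglongrightarrow> 0"
proof -
  have [measurable]: "s n \<in> borel_measurable M" for n using s by auto
  obtain r where r: "strict_mono r" "AE x in M. Cauchy (\<lambda>i. s (r i) x)"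
    by (rule cauchy_L1_AE_cauchy_subseq[where s = s and M = M, OF s]) (use Cauchy in simp_all)
  define v where "v x = lim (\<lambda>i. s (r i) x)" for x
  have [measurable]: "v \<in> borel_measurable M" unfolding v_def by measurable
  have lim: "AE x in M. (\<lambda>i. s (r i) x) \<longlonglongrightarrow> v x"
    using r(2) by eventually_elim (simp add: v_def Cauchy_convergent convergent_LIMSEQ_iff[symmetric])
  have bound: "(\<integral>\<^sup>+x. ennreal \<bar>s n x - v x\<bar> \<partial>M) \<le> ennreal e"
    if n0: "\<forall>j\<ge>n0. \<forall>k\<ge>n0. (\<integral>x. \<bar>s j x - s k x\<bar> \<partial>M) < e" and n: "n0 \<le> n" for n n0 e
  proof -
    have "(\<integral>\<^sup>+x. ennreal \<bar>s n x - v x\<bar> \<partial>M) = (\<integral>\<^sup>+x. liminf (\<lambda>i. ennreal \<bar>s n x - s (r i) x\<bar>) \<partial>M)"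
    proof (rule nn_integral_cong_AE)
      show "AE x in M. ennreal \<bar>s n x - v x\<bar> = liminf (\<lambda>i. ennreal \<bar>s n x - s (r i) x\<bar>)"
        using lim
      proof eventually_elim
        case (elim x)
        have "(\<lambda>i. ennreal \<bar>s n x - s (r i) x\<bar>) \<longlonglongrightarrow> ennreal \<bar>s n x - v x\<bar>"
          by (intro tendsto_ennrealI tendsto_intros elim)
        thus ?case using lim_imp_Liminf by (metis sequentially_bot)
      qed
    qed
    also have "\<dots> \<le> liminf (\<lambda>i. \<integral>\<^sup>+x. ennreal \<bar>s n x - s (r i) x\<bar> \<partial>M)"
      by (rule nn_integral_liminf) measurable
    also have "\<dots> \<le> ennreal e"
    proof (rule Liminf_le)
      show "\<forall>\<^sub>F i in sequentially. (\<integral>\<^sup>+x. ennreal \<bar>s n x - s (r i) x\<bar> \<partial>M) \<le> ennreal e"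
        using eventually_ge_at_top[of n0]
      proof eventually_elim
        case (elim i)
        have "(\<integral>\<^sup>+x. ennreal \<bar>s n x - s (r i) x\<bar> \<partial>M) = ennreal (\<integral>x. \<bar>s n x - s (r i) x\<bar> \<partial>M)"
          by (rule nn_integral_eq_integral) (use s in auto)
        also have "\<dots> \<le> ennreal e"
          using n0 n order_trans[OF elim seq_suble[OF r(1), of i]] by (intro ennreal_leI less_imp_le) auto
        finally show ?case .
      qed
    qed simp
    finally show ?thesis .
  qed
  obtain n1 where n1: "\<forall>j\<ge>n1. \<forall>k\<ge>n1. (\<integral>x. \<bar>s j x - s k x\<bar> \<partial>M) < 1" using Cauchy[of 1] by auto
  have "integrable M (\<lambda>x. s n1 x - v x)"
  proof (rule integrableI_bounded)
    show "(\<integral>\<^sup>+x. ennreal (norm (s n1 x - v x)) \<partial>M) < \<infinity>"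
      using bound[OF n1, of n1] by (simp add: order_le_less_trans ennreal_less_top)
  qed measurable
  from Bochner_Integration.integrable_diff[OF s[of n1] this] have v: "integrable M v" by simp
  have "(\<lambda>n. \<integral>x. \<bar>s n x - v x\<bar> \<partial>M) \<longlonglongrightarrow> 0"
  proof (rule LIMSEQ_I)
    fix e :: real assume "0 < e"
    then obtain n0 where n0: "\<forall>j\<ge>n0. \<forall>k\<ge>n0. (\<integral>x. \<bar>s j x - s k x\<bar> \<partial>M) < e / 2"
      using Cauchy[of "e / 2"] by auto
    have "norm ((\<integral>x. \<bar>s n x - v x\<bar> \<partial>M) - 0) < e" if "n0 \<le> n" for n
    proof -
      have "ennreal (\<integral>x. \<bar>s n x - v x\<bar> \<partial>M) = (\<integral>\<^sup>+x. ennreal \<bar>s n x - v x\<bar> \<partial>M)"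
        by (rule nn_integral_eq_integral[symmetric]) (use s v in auto)
      also have "\<dots> \<le> ennreal (e / 2)" by (rule bound[OF n0 that])
      finally have "(\<integral>x. \<bar>s n x - v x\<bar> \<partial>M) \<le> e / 2" using \<open>0 < e\<close> by simp
      moreover have "0 \<le> (\<integral>x. \<bar>s n x - v x\<bar> \<partial>M)" by simp
      ultimately show ?thesis using \<open>0 < e\<close> by simp
    qed
    thus "\<exists>no. \<forall>n\<ge>no. norm ((\<integral>x. \<bar>s n x - v x\<bar> \<partial>M) - 0) < e" by blast
  qed
  with v show ?thesis by (rule that)
qed

context axis_grid
begin

lemma step_function_L1_distance:
  "(\<integral>\<^sup>+x. ennreal \<bar>step_function c x - step_function c' x\<bar> \<partial>lborel)
    \<le> ennreal (\<Sum>K\<in>indices. \<bar>c K - c' K\<bar> * measure lborel (cell K))"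
proof -
  have "\<bar>step_function c x - step_function c' x\<bar> \<le> (\<Sum>K\<in>indices. \<bar>c K - c' K\<bar> * indicator (cell K) x)" for x
    unfolding step_function_def sum_subtractf[symmetric]
    by (intro order_trans[OF sum_abs] sum_mono) (auto simp: indicator_def)
  hence "(\<integral>\<^sup>+x. ennreal \<bar>step_function c x - step_function c' x\<bar> \<partial>lborel)
      \<le> (\<integral>\<^sup>+x. ennreal (\<Sum>K\<in>indices. \<bar>c K - c' K\<bar> * indicator (cell K) x) \<partial>lborel)"
    by (intro nn_integral_mono ennreal_leI)
  also have "\<dots> = (\<integral>\<^sup>+x. (\<Sum>K\<in>indices. ennreal \<bar>c K - c' K\<bar> * indicator (cell K) x) \<partial>lborel)"
    by (intro nn_integral_cong, subst sum_ennreal[symmetric]) (auto simp: ennreal_mult ennreal_indicator)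
  also have "\<dots> = (\<Sum>K\<in>indices. ennreal \<bar>c K - c' K\<bar> * emeasure lborel (cell K))"
    by (subst nn_integral_sum) (auto simp: nn_integral_cmult)
  also have "\<dots> = (\<Sum>K\<in>indices. ennreal (\<bar>c K - c' K\<bar> * measure lborel (cell K)))"
  proof (rule sum.cong)
    fix K
    have "emeasure lborel (cell K) \<noteq> top" using emeasure_cell_finite[of K] by simp
    thus "ennreal \<bar>c K - c' K\<bar> * emeasure lborel (cell K) = ennreal (\<bar>c K - c' K\<bar> * measure lborel (cell K))"
      by (simp add: ennreal_mult emeasure_eq_ennreal_measure)
  qed simp
  also have "\<dots> = ennreal (\<Sum>K\<in>indices. \<bar>c K - c' K\<bar> * measure lborel (cell K))"
    by (rule sum_ennreal) simp
  finally show ?thesis .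
qed

text \<open>
  Up to the averaging errors of both functions, their distance is measured by finitely many numbers.
  Integrals over cells are used instead of averages since they are bounded by the \<open>L\<^sup>1\<close> norm
  independently of the grid.
\<close>

lemma L1_distance_le_cell_integrals:
  assumes width: "\<And>K i. K \<in> indices \<Longrightarrow> p i (Suc (K i)) - p i (K i) = h i" and h: "\<And>i. 0 < h i"
    and tb: "translation_bounded (box a b) C w" "translation_bounded (box a b) C w'"
    and w: "integrable lborel w" "integrable lborel w'" and C: "0 \<le> C"
    and outside: "\<And>x. x \<notin> box a b \<Longrightarrow> w x = 0" "\<And>x. x \<notin> box a b \<Longrightarrow> w' x = 0"
  shows "(\<integral>x. \<bar>w x - w' x\<bar> \<partial>lborel) \<le> 2 * (2 ^ CARD('n) * C * (\<Sum>i\<in>UNIV. h i))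
     + (\<Sum>K\<in>indices. \<bar>(\<integral>y. indicator (cell K) y * w y \<partial>lborel) - (\<integral>y. indicator (cell K) y * w' y \<partial>lborel)\<bar>)"
    (is "_ \<le> 2 * ?E + ?S")
proof -
  let ?\<Omega> = "box a b"
  have [measurable]: "w \<in> borel_measurable borel" "w' \<in> borel_measurable borel" using w by auto
  define \<mu> where "\<mu> = (\<Prod>i\<in>UNIV. h i)"
  have \<mu>: "0 < \<mu>" unfolding \<mu>_def using h by (intro prod_pos) auto
  have measure_K: "measure lborel (cell K) = \<mu>" if "K \<in> indices" for K
    using width[OF that] by (simp add: measure_cell[OF that] \<mu>_def)
  define A where "A = step_function (\<lambda>K. (\<integral>y. indicator (cell K) y * w y \<partial>lborel) / \<mu>)"
  define A' where "A' = step_function (\<lambda>K. (\<integral>y. indicator (cell K) y * w' y \<partial>lborel) / \<mu>)"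
  have [measurable]: "A \<in> borel_measurable borel" "A' \<in> borel_measurable borel"
    unfolding A_def A'_def by measurable
  have E: "0 \<le> ?E" using C h by (intro mult_nonneg_nonneg sum_nonneg) (auto simp: less_imp_le)
  have S: "0 \<le> ?S" by (intro sum_nonneg) auto
  have "ennreal (\<integral>x. \<bar>w x - w' x\<bar> \<partial>lborel) = (\<integral>\<^sup>+x. ennreal \<bar>w x - w' x\<bar> \<partial>lborel)"
    by (rule nn_integral_eq_integral[symmetric]) (use w in auto)
  also have "\<dots> \<le> (\<integral>\<^sup>+x. indicator ?\<Omega> x * ennreal \<bar>w x - A x\<bar> + ennreal \<bar>A x - A' x\<bar>
      + indicator ?\<Omega> x * ennreal \<bar>w' x - A' x\<bar> \<partial>lborel)"
  proof (rule nn_integral_mono)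
    fix x
    have "ennreal \<bar>w x - w' x\<bar> \<le> ennreal \<bar>w x - A x\<bar> + ennreal \<bar>A x - A' x\<bar> + ennreal \<bar>w' x - A' x\<bar>"
      by (simp only: ennreal_plus[symmetric] abs_ge_zero add_nonneg_nonneg) (rule ennreal_leI, linarith)
    thus "ennreal \<bar>w x - w' x\<bar> \<le> indicator ?\<Omega> x * ennreal \<bar>w x - A x\<bar> + ennreal \<bar>A x - A' x\<bar>
      + indicator ?\<Omega> x * ennreal \<bar>w' x - A' x\<bar>"
      using outside[of x] by (cases "x \<in> ?\<Omega>") auto
  qed
  also have "\<dots> = (\<integral>\<^sup>+x. indicator ?\<Omega> x * ennreal \<bar>w x - A x\<bar> \<partial>lborel) + (\<integral>\<^sup>+x. ennreal \<bar>A x - A' x\<bar> \<partial>lborel)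
      + (\<integral>\<^sup>+x. indicator ?\<Omega> x * ennreal \<bar>w' x - A' x\<bar> \<partial>lborel)"
    by (subst nn_integral_add, measurable)+
  also have "\<dots> \<le> ennreal ?E + ennreal ?S + ennreal ?E"
  proof (intro add_mono)
    show "(\<integral>\<^sup>+x. indicator ?\<Omega> x * ennreal \<bar>w x - A x\<bar> \<partial>lborel) \<le> ennreal ?E"
      unfolding A_def \<mu>_def by (intro uniform_average_error width h tb w C)
    show "(\<integral>\<^sup>+x. indicator ?\<Omega> x * ennreal \<bar>w' x - A' x\<bar> \<partial>lborel) \<le> ennreal ?E"
      unfolding A'_def \<mu>_def by (intro uniform_average_error width h tb w C)
    have "(\<Sum>K\<in>indices. \<bar>(\<integral>y. indicator (cell K) y * w y \<partial>lborel) / \<mu> - (\<integral>y. indicator (cell K) y * w' y \<partial>lborel) / \<mu>\<bar>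
        * measure lborel (cell K)) = ?S"
      by (rule sum.cong) (use \<mu> in \<open>simp_all add: measure_K diff_divide_distrib[symmetric] abs_divide\<close>)
    thus "(\<integral>\<^sup>+x. ennreal \<bar>A x - A' x\<bar> \<partial>lborel) \<le> ennreal ?S"
      unfolding A_def A'_def
      using step_function_L1_distance[of "\<lambda>K. (\<integral>y. indicator (cell K) y * w y \<partial>lborel) / \<mu>"
        "\<lambda>K. (\<integral>y. indicator (cell K) y * w' y \<partial>lborel) / \<mu>"] by simp
  qed
  also have "\<dots> = ennreal (2 * ?E + ?S)"
    using E S by (simp only: ennreal_plus[symmetric] add_nonneg_nonneg) (simp add: algebra_simps)
  finally show ?thesis
    using E S by (subst (asm) ennreal_le_iff) auto
qed

end

lemma uniform_axis_grid:
  assumes "\<And>i. a $ i < b $ i"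
  shows "axis_grid a b (\<lambda>_. Suc m) (\<lambda>i k. a $ i + real k * ((b $ i - a $ i) / real (Suc m)))"
proof
  fix i and k :: nat
  have "(b $ i - a $ i) / real (Suc m) > 0" using assms by simp
  thus "a $ i + real k * ((b $ i - a $ i) / real (Suc m)) < a $ i + real (Suc k) * ((b $ i - a $ i) / real (Suc m))"
    by (intro add_strict_left_mono mult_strict_right_mono) auto
qed simp_all

text \<open>
  The index set of all integrals over cells of all uniform grids is countable, so a single diagonal
  subsequence makes them converge.
\<close>

lemma translation_bounded_compact:
  fixes W :: "nat \<Rightarrow> real^'n \<Rightarrow> real"
  assumes ab: "\<And>i. a $ i < b $ i"
    and W: "\<And>k. integrable lborel (W k)" and outside: "\<And>k x. x \<notin> box a b \<Longrightarrow> W k x = 0"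
    and tb: "\<And>k. translation_bounded (box a b) C (W k)" and C: "0 \<le> C"
    and L1: "\<And>k. (\<integral>x. \<bar>W k x\<bar> \<partial>lborel) \<le> D"
  obtains r v where "strict_mono (r :: nat \<Rightarrow> nat)" "integrable lborel v"
    "(\<lambda>k. \<integral>x. \<bar>W (r k) x - v x\<bar> \<partial>lborel) \<longlonglongrightarrow> 0"
proof -
  define h where "h m i = (b $ i - a $ i) / real (Suc m)" for m :: nat and i
  define p where "p m = (\<lambda>i k. a $ i + real k * h m i)" for m :: nat
  have grid: "axis_grid a b (\<lambda>_. Suc m) (p m)" for m
    unfolding p_def h_def by (rule uniform_axis_grid[OF ab])
  have h: "0 < h m i" for m i using ab by (simp add: h_def)
  have width: "p m i (Suc k) - p m i k = h m i" for m i k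
    by (simp add: p_def algebra_simps)
  define coef where "coef k = (\<lambda>(m, K). \<integral>y. indicator (axis_grid.cell (p m) K) y * W k y \<partial>lborel)" for k
  have coef: "norm (coef k mK) \<le> D" for k mK
  proof -
    obtain m K where mK: "mK = (m, K)" by force
    have [measurable]: "axis_grid.cell (p m) K \<in> sets borel" by (rule axis_grid.cell_borel[OF grid])
    have int: "integrable lborel (\<lambda>y. indicator (axis_grid.cell (p m) K) y * W k y)"
      using integrable_mult_indicator[OF _ W[of k], of "axis_grid.cell (p m) K"] by simp
    have "norm (coef k mK) \<le> (\<integral>y. \<bar>indicator (axis_grid.cell (p m) K) y * W k y\<bar> \<partial>lborel)"
      unfolding coef_def mK by (simp add: integral_abs_bound)
    also have "\<dots> \<le> (\<integral>y. \<bar>W k y\<bar> \<partial>lborel)"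
      by (rule integral_mono) (use int W in \<open>auto simp: indicator_def\<close>)
    finally show ?thesis using L1[of k] by linarith
  qed
  obtain r where r: "strict_mono (r :: nat \<Rightarrow> nat)" "\<And>mK. \<exists>l. (\<lambda>n. coef (r n) mK) \<longlonglongrightarrow> l"
    by (rule function_convergent_subsequence[of "UNIV :: (nat \<times> ('n \<Rightarrow> nat)) set" coef D, OF countableI_type coef]) blast
  have dist: "(\<integral>x. \<bar>W j x - W k x\<bar> \<partial>lborel) \<le> 2 * (2 ^ CARD('n) * C * (\<Sum>i\<in>UNIV. h m i))
     + (\<Sum>K\<in>axis_grid.indices (\<lambda>_. Suc m). \<bar>coef j (m, K) - coef k (m, K)\<bar>)" for j k m
    unfolding coef_def prod.case
    by (rule axis_grid.L1_distance_le_cell_integrals[OF grid width h tb tb W W C outside outside])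
  have "\<exists>n0. \<forall>j\<ge>n0. \<forall>k\<ge>n0. (\<integral>x. \<bar>W (r j) x - W (r k) x\<bar> \<partial>lborel) < e" if e: "0 < e" for e
  proof -
    \<comment> \<open>\<open>B / Suc m\<close> is the averaging error of both functions on the grid with \<open>Suc m\<close> cells per direction.\<close>
    define B where "B = 2 * (2 ^ CARD('n) * C * (\<Sum>i\<in>UNIV. b $ i - a $ i))"
    have "(\<lambda>m. B * (1 / real (Suc m))) \<longlonglongrightarrow> B * 0"
      using LIMSEQ_inverse_real_of_nat by (intro tendsto_mult tendsto_const) (simp add: inverse_eq_divide)
    hence "eventually (\<lambda>m. B * (1 / real (Suc m)) < e / 2) sequentially"
      using e by (intro order_tendstoD) auto
    then obtain m where m: "B * (1 / real (Suc m)) < e / 2" by (auto simp: eventually_sequentially)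
    have Bm: "2 * (2 ^ CARD('n) * C * (\<Sum>i\<in>UNIV. h m i)) = B * (1 / real (Suc m))"
      by (simp add: B_def h_def sum_divide_distrib[symmetric])
    let ?I = "axis_grid.indices (\<lambda>_. Suc m) :: ('n \<Rightarrow> nat) set"
    have fin: "finite ?I" by (rule axis_grid.finite_indices[OF grid])
    define \<delta> where "\<delta> = e / (2 * (1 + real (card ?I)))"
    have \<delta>: "0 < \<delta>" using e by (simp add: \<delta>_def)
    have "\<exists>n0. \<forall>j\<ge>n0. \<forall>k\<ge>n0. \<bar>coef (r j) (m, K) - coef (r k) (m, K)\<bar> < \<delta>" for K
    proof -
      obtain l where "(\<lambda>n. coef (r n) (m, K)) \<longlonglongrightarrow> l" using r(2) by blast
      hence "Cauchy (\<lambda>n. coef (r n) (m, K))" by (rule LIMSEQ_imp_Cauchy)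
      thus ?thesis using \<delta> unfolding Cauchy_def by (simp add: dist_real_def)
    qed
    then obtain n0 where n0: "\<And>K j k. n0 K \<le> j \<Longrightarrow> n0 K \<le> k \<Longrightarrow> \<bar>coef (r j) (m, K) - coef (r k) (m, K)\<bar> < \<delta>"
      by metis
    define n where "n = Max (insert 0 (n0 ` ?I))"
    have n: "n0 K \<le> n" if "K \<in> ?I" for K unfolding n_def using fin that by (intro Max_ge) auto
    have "(\<integral>x. \<bar>W (r j) x - W (r k) x\<bar> \<partial>lborel) < e" if jk: "n \<le> j" "n \<le> k" for j k
    proof -
      have "(\<Sum>K\<in>?I. \<bar>coef (r j) (m, K) - coef (r k) (m, K)\<bar>) \<le> (\<Sum>K\<in>?I. \<delta>)"
      proof (rule sum_mono)
        fix K assume "K \<in> ?I"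
        from n[OF this] show "\<bar>coef (r j) (m, K) - coef (r k) (m, K)\<bar> \<le> \<delta>"
          using n0[of K j k] jk by (simp add: less_imp_le)
      qed
      also have "\<dots> \<le> (1 + real (card ?I)) * \<delta>" using \<delta> by (simp add: distrib_right)
      also have "\<dots> = e / 2" by (simp add: \<delta>_def field_simps)
      finally show ?thesis using dist[of "r j" "r k" m] m unfolding Bm by linarith
    qed
    thus ?thesis by blast
  qed
  then obtain v where "integrable lborel v" "(\<lambda>n. \<integral>x. \<bar>W (r n) x - v x\<bar> \<partial>lborel) \<longlonglongrightarrow> 0"
    using L1_Cauchy_convergent[of lborel "\<lambda>n. W (r n)"] W by blast
  with r(1) show ?thesis by (rule that)
qed

section \<open>Bounded variation of the limit\<close>

text \<open>
  Each coordinate contributes at most \<open>C\<close> to \<open>\<integral> W k div \<phi>\<close>, since the components of \<open>\<phi>\<close> are bounded by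
  its Euclidean norm. The divergence is bounded, so the estimate survives convergence in \<open>L\<^sup>1\<close>.
\<close>

lemma BV_of_translation_bounded_limit:
  fixes W :: "nat \<Rightarrow> real^'n \<Rightarrow> real"
  assumes W: "\<And>k. integrable lborel (W k)"
    and tb: "\<And>k. translation_bounded \<Omega> C (W k)" and C: "0 \<le> C" and \<Omega>: "open \<Omega>"
    and v: "integrable lborel v" and lim: "(\<lambda>k. \<integral>x. \<bar>W k x - v x\<bar> \<partial>lborel) \<longlonglongrightarrow> 0"
  shows "v \<in> BV \<Omega>"
proof -
  have [measurable]: "v \<in> borel_measurable borel" "\<And>k. W k \<in> borel_measurable borel" using v W by auto
  have [measurable]: "\<Omega> \<in> sets borel" using \<Omega> by auto
  have "integrable lborel (\<lambda>x. indicator \<Omega> x * v x)"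
    using integrable_mult_indicator[OF _ v, of \<Omega>] by simp
  hence int: "integrable (lebesgue_on \<Omega>) v" by (subst integrable_lebesgue_on_borel) auto
  have "(\<integral>x. v x * divergence \<phi> x \<partial>lebesgue_on \<Omega>) \<le> CARD('n) * C"
    if \<phi>: "C1_compact \<Omega> \<phi>" "\<And>x. norm (\<phi> x) \<le> 1" for \<phi> :: "real^'n \<Rightarrow> real^'n"
  proof -
    obtain K where K: "compact K" "K \<subseteq> \<Omega>" "\<And>x. x \<notin> K \<Longrightarrow> \<phi> x = 0" and C1: "C1 \<phi>"
      using \<phi>(1) by (auto simp: C1_compact_def)
    define f where "f i x = \<phi> x $ i" for i x
    have deriv: "(f i has_derivative (\<lambda>h. frechet_derivative \<phi> (at x) h $ i)) (at x)" for i x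
      unfolding f_def using C1_has_derivative[OF C1, of x] by (rule bounded_linear.has_derivative[OF bounded_linear_vec_nth])
    have frechet: "frechet_derivative (f i) (at x) = (\<lambda>h. frechet_derivative \<phi> (at x) h $ i)" for i x
      by (rule frechet_derivative_at[OF deriv, symmetric])
    have C1_f: "C1 (f i)" for i
      unfolding C1_def frechet
    proof (intro conjI allI)
      show "f i differentiable_on UNIV"
        using deriv by (auto simp: differentiable_on_def differentiable_def)
      show "continuous_on UNIV (\<lambda>x. frechet_derivative \<phi> (at x) h $ i)" for h
        using C1 by (auto simp: C1_def intro!: continuous_on_component)
    qed
    have f_le: "\<bar>f i x\<bar> \<le> 1" for i x
      using order_trans[OF component_le_norm_cart \<phi>(2)] by (simp add: f_def)
    have f_K: "x \<notin> K \<Longrightarrow> f i x = 0" for i x by (simp add: f_def K(3))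
    define g where "g x = (\<Sum>i\<in>UNIV. partial i (f i) x)" for x
    have div: "divergence \<phi> x = g x" for x by (simp add: divergence_def g_def frechet)
    note [measurable] = C1_partial_measurable[OF C1_f]
    have [measurable]: "g \<in> borel_measurable borel" unfolding g_def by measurable
    have W_le: "(\<integral>x. W k x * g x \<partial>lborel) \<le> CARD('n) * C" and int_Wg: "integrable lborel (\<lambda>x. W k x * g x)" for k
    proof -
      note wp = translation_bounded_weak_partial[OF W tb C \<Omega> C1_f f_le K(1,2) f_K]
      show "integrable lborel (\<lambda>x. W k x * g x)"
        unfolding g_def sum_distrib_left using wp(1) by (intro Bochner_Integration.integrable_sum)
      have "(\<integral>x. W k x * g x \<partial>lborel) = (\<Sum>i\<in>UNIV. \<integral>x. W k x * partial i (f i) x \<partial>lborel)"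
        unfolding g_def sum_distrib_left using wp(1) by (intro Bochner_Integration.integral_sum)
      also have "\<dots> \<le> (\<Sum>i\<in>(UNIV :: 'n set). C)" by (intro sum_mono wp(2))
      finally show "(\<integral>x. W k x * g x \<partial>lborel) \<le> CARD('n) * C" by simp
    qed
    have cont_g: "continuous_on UNIV g"
      unfolding g_def by (intro continuous_on_sum C1_partial_continuous C1_f)
    have "bounded (g ` K)"
      by (intro compact_imp_bounded compact_continuous_image continuous_on_subset[OF cont_g] K) auto
    then obtain M where M: "\<And>x. x \<in> K \<Longrightarrow> \<bar>g x\<bar> \<le> M" by (auto simp: bounded_iff)
    \<comment> \<open>Outside the support the derivative vanishes because the complement of \<open>K\<close> is open.\<close>
    have g_0: "g x = 0" if "x \<notin> K" for x
    proof -
      have "open (- K)" using compact_imp_closed[OF K(1)] by (rule open_Compl)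
      have "(f i has_derivative (\<lambda>h. 0)) (at x)" for i
        by (rule has_derivative_transform_within_open[OF has_derivative_const \<open>open (- K)\<close>])
          (use that f_K in auto)
      hence "frechet_derivative (f i) (at x) = (\<lambda>h. 0)" for i
        by (rule frechet_derivative_at[symmetric])
      thus ?thesis by (simp add: g_def)
    qed
    define B where "B = max 0 M"
    have B: "\<bar>g x\<bar> \<le> B" for x using M[of x] g_0[of x] by (cases "x \<in> K") (auto simp: B_def)
    have int_vg: "integrable lborel (\<lambda>x. v x * g x)"
    proof (rule Bochner_Integration.integrable_bound)
      show "integrable lborel (\<lambda>x. B * v x)" using v by simp
      show "AE x in lborel. norm (v x * g x) \<le> norm (B * v x)"
      proof (rule AE_I2)
        fix x
        have "\<bar>v x\<bar> * \<bar>g x\<bar> \<le> \<bar>v x\<bar> * B" by (rule mult_left_mono[OF B]) simp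
        thus "norm (v x * g x) \<le> norm (B * v x)" by (simp add: abs_mult B_def mult.commute)
      qed
    qed measurable
    have B_lim: "(\<lambda>k. B * (\<integral>x. \<bar>W k x - v x\<bar> \<partial>lborel)) \<longlonglongrightarrow> 0"
      using tendsto_mult[OF tendsto_const lim, of B] by simp
    have "(\<lambda>k. (\<integral>x. W k x * g x \<partial>lborel) - (\<integral>x. v x * g x \<partial>lborel)) \<longlonglongrightarrow> 0"
    proof (rule Lim_null_comparison[OF _ B_lim], intro always_eventually allI)
      fix k
      have "\<bar>(\<integral>x. W k x * g x \<partial>lborel) - (\<integral>x. v x * g x \<partial>lborel)\<bar> = \<bar>\<integral>x. (W k x - v x) * g x \<partial>lborel\<bar>"
        using int_Wg int_vg by (simp add: left_diff_distrib)
      also have "\<dots> \<le> (\<integral>x. \<bar>(W k x - v x) * g x\<bar> \<partial>lborel)" by (rule integral_abs_bound)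
      also have "\<dots> \<le> (\<integral>x. B * \<bar>W k x - v x\<bar> \<partial>lborel)"
      proof (rule integral_mono)
        show "integrable lborel (\<lambda>x. \<bar>(W k x - v x) * g x\<bar>)"
          using int_Wg[of k] int_vg by (simp add: left_diff_distrib)
        show "\<bar>(W k x - v x) * g x\<bar> \<le> B * \<bar>W k x - v x\<bar>" for x
          using mult_right_mono[OF B[of x], of "\<bar>W k x - v x\<bar>"] by (simp add: abs_mult mult.commute)
      qed (use W v in auto)
      finally show "norm ((\<integral>x. W k x * g x \<partial>lborel) - (\<integral>x. v x * g x \<partial>lborel)) \<le> B * (\<integral>x. \<bar>W k x - v x\<bar> \<partial>lborel)"
        by simp
    qed
    hence "(\<lambda>k. \<integral>x. W k x * g x \<partial>lborel) \<longlonglongrightarrow> (\<integral>x. v x * g x \<partial>lborel)" by (rule Lim_null[THEN iffD2])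
    hence "(\<integral>x. v x * g x \<partial>lborel) \<le> CARD('n) * C"
      by (rule LIMSEQ_le_const2) (use W_le in auto)
    moreover have "(\<integral>x. v x * divergence \<phi> x \<partial>lebesgue_on \<Omega>) = (\<integral>x. indicator \<Omega> x * (v x * g x) \<partial>lborel)"
      unfolding div by (rule integral_lebesgue_on_borel) auto
    moreover have "\<dots> = (\<integral>x. v x * g x \<partial>lborel)"
      by (rule Bochner_Integration.integral_cong) (use g_0 K(2) in \<open>auto simp: indicator_def\<close>)
    ultimately show ?thesis by simp
  qed
  hence "total_variation \<Omega> v \<le> ereal (CARD('n) * C)"
    unfolding total_variation_def by (intro SUP_least) auto
  thus ?thesis using int by (auto simp: BV_def)
qed

section \<open>Compactness of the discrete functions\<close>

lemma is_axis_grid_axis_grid: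
  assumes "is_axis_grid a b \<Q>"
  obtains N p where "axis_grid a b N p" "\<Q> = axis_grid.cell p ` axis_grid.indices N"
proof -
  obtain N p where Np: "\<forall>i. p i 0 = a $ i \<and> p i (N i) = b $ i \<and> (\<forall>k < N i. p i k < p i (Suc k))"
    and \<Q>: "\<Q> = {box (\<chi> i. p i (K i)) (\<chi> i. p i (Suc (K i))) | K. \<forall>i. K i < N i}"
    using assms unfolding is_axis_grid_def by blast
  have grid: "axis_grid a b N p" using Np by unfold_locales auto
  have "\<Q> = axis_grid.cell p ` axis_grid.indices N"
    unfolding \<Q> axis_grid.indices_def[OF grid] axis_grid.cell_def[OF grid] by auto
  with grid show ?thesis by (rule that)
qed

theorem theorem4p23:
  fixes a b :: "real^'n"
    and \<Omega> :: "(real^'n) set"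
    and \<tau> :: "nat \<Rightarrow> real"
    and \<Q> :: "nat \<Rightarrow> (real^'n) set set"
    and w :: "nat \<Rightarrow> real^'n \<Rightarrow> real"
    and C :: real
  assumes dim: "CARD('n) \<in> {1, 2, 3}"
    and box: "\<forall>i. a $ i < b $ i" "\<Omega> = box a b"
    and mesh_pos: "\<forall>k. 0 < \<tau> k"
    and mesh_lim: "\<tau> \<longlonglongrightarrow> 0"
    and grid: "\<forall>k. is_axis_grid a b (\<Q> k)"
    and mesh: "\<forall>k. \<forall>Q \<in> \<Q> k. diameter Q \<le> \<tau> k"
    and ecc: "\<exists>\<kappa>. \<forall>k. eccentricity_bounded_by \<kappa> (\<Q> k)"
    and L2: "\<forall>k. L2_on \<Omega> (w k)"
    and avg: "\<forall>k. AE x in lebesgue_on \<Omega>. w k x = cell_average (\<Q> k) (w k) x"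
    and C_pos: "0 < C"
    and TV_bound: "\<forall>k. TV_grid \<Omega> (\<Q> k) (w k) \<le> ereal C"
    and L1_bound: "\<forall>k. (\<integral>x. \<bar>w k x\<bar> \<partial>lebesgue_on \<Omega>) \<le> C"
  shows "\<exists>(r :: nat \<Rightarrow> nat) v. strict_mono r \<and> v \<in> BV \<Omega> \<and>
    (\<lambda>k. \<integral>x. \<bar>w (r k) x - v x\<bar> \<partial>lebesgue_on \<Omega>) \<longlonglongrightarrow> 0"
proof -
  have \<Omega>_borel [measurable]: "\<Omega> \<in> sets borel" using box by simp
  \<comment> \<open>Each \<open>w k\<close> is replaced by a Borel representative that is constant on the cells and zero outside \<open>\<Omega>\<close>.\<close>
  have "\<exists>W. integrable lborel W \<and> (\<forall>x. x \<notin> \<Omega> \<longrightarrow> W x = 0) \<and> translation_bounded \<Omega> C W \<and>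
      (AE x in lebesgue_on \<Omega>. w k x = W x)" for k
  proof -
    obtain N p where Np: "axis_grid a b N p" "\<Q> k = axis_grid.cell p ` axis_grid.indices N"
      using is_axis_grid_axis_grid grid by blast
    interpret axis_grid a b N p by (rule Np)
    define c where "c K = 1 / measure lebesgue (cell K) * (\<integral>y. w k y \<partial>lebesgue_on (cell K))" for K
    have average_eq: "cell_average (\<Q> k) (w k) x = step_function c x" for x
      unfolding cell_average_def step_function_def Np(2) sum.reindex[OF inj_on_cell]
      by (rule sum.cong) (auto simp: c_def)
    have w_eq: "AE x in lebesgue_on \<Omega>. w k x = step_function c x"
      using avg[rule_format, of k] unfolding average_eq .
    have "integrable lborel (step_function c)"
      unfolding step_function_def[abs_def] using emeasure_cell_finite
      by (intro Bochner_Integration.integrable_sum integrable_mult_right integrable_real_indicator) auto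
    moreover have "step_function c x = 0" if "x \<notin> \<Omega>" for x
      unfolding step_function_def using that box cell_subset by (intro sum.neutral) (auto simp: indicator_def)
    moreover have "translation_bounded \<Omega> C (step_function c)"
      unfolding box(2)
    proof (rule step_function_translation_bounded)
      show "(\<Sum>K\<in>faces i. \<bar>c (next_index i K) - c K\<bar> * face_area i K) \<le> C" for i
      proof (rule sum_jumps_le_TV_grid)
        show "TV_grid (box a b) (cell ` indices) (w k) \<le> ereal C"
          using TV_bound[rule_format, of k] unfolding box(2) Np(2) .
        show "AE x in lebesgue_on (box a b). w k x = step_function c x"
          using w_eq unfolding box(2) .
        show "w k \<in> borel_measurable (lebesgue_on (box a b))"
          using L2 unfolding L2_on_def box(2) by blast
      qed
    qed
    ultimately show ?thesis using w_eq by blast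
  qed
  then obtain W where W: "\<And>k. integrable lborel (W k)" "\<And>k x. x \<notin> \<Omega> \<Longrightarrow> W k x = 0"
    "\<And>k. translation_bounded \<Omega> C (W k)" "\<And>k. AE x in lebesgue_on \<Omega>. w k x = W k x"
    by metis
  have [measurable]: "W k \<in> borel_measurable borel" for k using W(1)[of k] by auto
  have w_meas: "w k \<in> borel_measurable (lebesgue_on \<Omega>)" for k using L2 by (auto simp: L2_on_def)
  have transfer: "(\<integral>x. \<bar>w k x - u x\<bar> \<partial>lebesgue_on \<Omega>) = (\<integral>x. indicator \<Omega> x * \<bar>W k x - u x\<bar> \<partial>lborel)"
    if [measurable]: "u \<in> borel_measurable borel" for k u
  proof -
    have "(\<integral>x. \<bar>w k x - u x\<bar> \<partial>lebesgue_on \<Omega>) = (\<integral>x. \<bar>W k x - u x\<bar> \<partial>lebesgue_on \<Omega>)"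
    proof (rule integral_cong_AE)
      show "(\<lambda>x. \<bar>w k x - u x\<bar>) \<in> borel_measurable (lebesgue_on \<Omega>)"
        by (intro borel_measurable_abs borel_measurable_diff w_meas borel_measurable_lebesgue_on that)
      show "(\<lambda>x. \<bar>W k x - u x\<bar>) \<in> borel_measurable (lebesgue_on \<Omega>)"
        by (intro borel_measurable_lebesgue_on) measurable
      show "AE x in lebesgue_on \<Omega>. \<bar>w k x - u x\<bar> = \<bar>W k x - u x\<bar>"
        using W(4)[of k] by eventually_elim simp
    qed
    also have "\<dots> = (\<integral>x. indicator \<Omega> x * \<bar>W k x - u x\<bar> \<partial>lborel)"
      by (rule integral_lebesgue_on_borel) auto
    finally show ?thesis .
  qed
  have L1: "(\<integral>x. \<bar>W k x\<bar> \<partial>lborel) \<le> C" for k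
  proof -
    have "(\<integral>x. \<bar>W k x\<bar> \<partial>lborel) = (\<integral>x. indicator \<Omega> x * \<bar>W k x - 0\<bar> \<partial>lborel)"
      by (rule Bochner_Integration.integral_cong) (use W(2)[of _ k] in \<open>auto simp: indicator_def\<close>)
    also have "\<dots> = (\<integral>x. \<bar>w k x\<bar> \<partial>lebesgue_on \<Omega>)" using transfer[of "\<lambda>_. 0" k] by simp
    finally show ?thesis using L1_bound by simp
  qed
  obtain r v where r: "strict_mono (r :: nat \<Rightarrow> nat)" and v: "integrable lborel v"
    and lim: "(\<lambda>k. \<integral>x. \<bar>W (r k) x - v x\<bar> \<partial>lborel) \<longlonglongrightarrow> 0"
    by (rule translation_bounded_compact[of a b W C C]) (use box W L1 C_pos in auto)
  have [measurable]: "v \<in> borel_measurable borel" using v by auto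
  have "v \<in> BV \<Omega>"
    by (rule BV_of_translation_bounded_limit[of "\<lambda>k. W (r k)" \<Omega> C]) (use box W C_pos v lim in auto)
  moreover have "(\<lambda>k. \<integral>x. \<bar>w (r k) x - v x\<bar> \<partial>lebesgue_on \<Omega>) \<longlonglongrightarrow> 0"
  proof (rule tendsto_sandwich[OF _ _ tendsto_const lim])
    have "(\<integral>x. indicator \<Omega> x * \<bar>W (r k) x - v x\<bar> \<partial>lborel) \<le> (\<integral>x. \<bar>W (r k) x - v x\<bar> \<partial>lborel)" for k
    proof (rule integral_mono)
      show "integrable lborel (\<lambda>x. indicator \<Omega> x * \<bar>W (r k) x - v x\<bar>)"
        using integrable_mult_indicator[of \<Omega> lborel "\<lambda>x. \<bar>W (r k) x - v x\<bar>"] W(1) v by simp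
    qed (use W(1) v in \<open>auto simp: indicator_def\<close>)
    thus "\<forall>\<^sub>F k in sequentially. (\<integral>x. \<bar>w (r k) x - v x\<bar> \<partial>lebesgue_on \<Omega>) \<le> (\<integral>x. \<bar>W (r k) x - v x\<bar> \<partial>lborel)"
      by (simp add: transfer)
  qed simp
  ultimately show ?thesis using r by blast
qed

end
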